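(* A finite undirected simple outerplanar graph $G$ (with at least one vertex) can be oriented as an oclique if and only if $G$ contains a spanning subgraph isomorphic to one of the following eleven graphs: (a) the one-vertex graph $K_1$; (b) the graph $K_2$ (a single edge); (c) the path on $3$ vertices; (d) the cycle $C_4$; (e) the graph on $\{p,q,r,s\}$ with edges $pq, qr, pr, rs$ (a triangle with one pendant edge); (f) the cycle $C_5$; (g) the graph on $\{z,p_1,p_2,q_1,q_2\}$ with edges $zp_1,zp_2,zq_1,zq_2,p_1p_2,q_1q_2$ (two triangles sharing a vertex); (h) the graph on $\{z,s,p_1,p_2,p_3\}$ with edges $zs,zp_1,zp_2,zp_3,p_1p_2,p_2p_3$; (i) the graph on $\{t,l,r,b,l',r'\}$ with edges $tl,\ lb,\ br,\ rt,\ ll',\ l'b,\ br',\ r'r$; (j) the graph on $\{z,p_1,p_2,q_1,q_2,q_3\}$ with edges $zp_1,zp_2,zq_1,zq_2,zq_3,p_1p_2,q_1q_2,q_2q_3$; (k) the graph on $\{z,p_1,p_2,p_3,q_1,q_2,q_3\}$ with edges $zp_1,zp_2,zp_3,zq_1,zq_2,zq_3,p_1p_2,p_2p_3,q_1q_2,q_2q_3$.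
   Context: An oriented graph is a digraph with no directed cycle of length $1$ or $2$; it is obtained from a finite simple graph $G$ (its underlying graph) by replacing each edge $uv$ by exactly one of the arcs $\overrightarrow{uv}$, $\overrightarrow{vu}$, and is then called an orientation of $G$. The oriented chromatic number $\chi_o(\overrightarrow{G})$ of an oriented graph $\overrightarrow{G}$ is the minimum order (number of vertices) of an oriented graph $\overrightarrow{H}$ such that there is an arc-preserving map $V(\overrightarrow{G})\to V(\overrightarrow{H})$. An oclique is an oriented graph $\overrightarrow{G}$ with $\chi_o(\overrightarrow{G})=|V(\overrightarrow{G})|$; equivalently, any two distinct vertices $u,v$ are either adjacent or are the two end-vertices of a directed path with two arcs (in one direction or the other), i.e. there is $w$ with arcs $\overrightarrow{uw},\overrightarrow{wv}$ or arcs $\overrightarrow{vw},\overrightarrow{wu}$. A graph "can be oriented as an oclique" if it has an orientation that is an oclique. A spanning subgraph of $G$ is a (not necessarily induced) subgraph containing all the vertices of $G$. Graphs are finite and have at least one vertex. *)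

theory Defs
  imports "HOL-Analysis.Analysis" "Graph_Theory.Digraph_Isomorphism"
begin

text \<open>
  Digraphs without parallel arcs are records with fields \<open>pverts\<close> and \<open>parcs\<close>. Following the
  Graph Theory library, a finite simple graph is a symmetric loop-free finite digraph
  (\<open>pair_graph\<close>): the edge \<open>uv\<close> is the pair of arcs \<open>(u,v)\<close>, \<open>(v,u)\<close>. The library locales admit
  the null graph.
\<close>

section \<open>Oriented graphs and ocliques\<close>

definition oriented_graph :: "'a pair_pre_digraph \<Rightarrow> bool" where
  "oriented_graph D \<longleftrightarrow> pair_digraph D \<and> asym (parcs D)"

definition orientation_of :: "'a pair_pre_digraph \<Rightarrow> 'a pair_pre_digraph \<Rightarrow> bool" where
  "orientation_of G D \<longleftrightarrow> oriented_graph D \<and> mk_symmetric (with_proj D) = G"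

definition arc_preserving ::
  "'a pair_pre_digraph \<Rightarrow> 'b pair_pre_digraph \<Rightarrow> ('a \<Rightarrow> 'b) \<Rightarrow> bool" where
  "arc_preserving D H f \<longleftrightarrow>
     f \<in> pverts D \<rightarrow> pverts H \<and> (\<forall>(u, v) \<in> parcs D. (f u, f v) \<in> parcs H)"

text \<open>
  The targets range over oriented graphs on natural numbers; since they are finite, this is no
  restriction up to isomorphism. For finite \<open>D\<close> the minimum exists: an oriented \<open>D\<close> maps
  to a copy of itself.
\<close>

definition oriented_chromatic_number :: "'a pair_pre_digraph \<Rightarrow> nat" where
  "oriented_chromatic_number D =
     (LEAST k. \<exists>(H :: nat pair_pre_digraph) f.
        oriented_graph H \<and> card (pverts H) = k \<and> arc_preserving D H f)"

definition oclique :: "'a pair_pre_digraph \<Rightarrow> bool" where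
  "oclique D \<longleftrightarrow> oriented_graph D \<and> oriented_chromatic_number D = card (pverts D)"

definition orientable_as_oclique :: "'a pair_pre_digraph \<Rightarrow> bool" where
  "orientable_as_oclique G \<longleftrightarrow> (\<exists>D. orientation_of G D \<and> oclique D)"


section \<open>Outerplanar graphs\<close>

text \<open>
  In a plane drawing \<open>p\<close> places the vertices and \<open>\<gamma> u v\<close> is a simple arc drawing the edge \<open>uv\<close>. Both
  arcs of an edge carry the same curve, traversed in opposite directions. Vertices meet an edge
  only as its ends, and distinct edges meet only in common ends.
\<close>

definition plane_drawing ::
  "'a pair_pre_digraph \<Rightarrow> ('a \<Rightarrow> complex) \<Rightarrow> ('a \<Rightarrow> 'a \<Rightarrow> real \<Rightarrow> complex) \<Rightarrow> bool" where
  "plane_drawing G p \<gamma> \<longleftrightarrow>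
     inj_on p (pverts G) \<and>
     (\<forall>(u, v) \<in> parcs G.
        arc (\<gamma> u v) \<and> pathstart (\<gamma> u v) = p u \<and> pathfinish (\<gamma> u v) = p v \<and>
        \<gamma> v u = reversepath (\<gamma> u v) \<and>
        path_image (\<gamma> u v) \<inter> p ` pverts G = {p u, p v}) \<and>
     (\<forall>(u, v) \<in> parcs G. \<forall>(x, y) \<in> parcs G. {u, v} \<noteq> {x, y} \<longrightarrow>
        path_image (\<gamma> u v) \<inter> path_image (\<gamma> x y) \<subseteq> p ` ({u, v} \<inter> {x, y}))"

definition drawing_points ::
  "'a pair_pre_digraph \<Rightarrow> ('a \<Rightarrow> complex) \<Rightarrow> ('a \<Rightarrow> 'a \<Rightarrow> real \<Rightarrow> complex) \<Rightarrow> complex set" where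
  "drawing_points G p \<gamma> = p ` pverts G \<union> (\<Union>(u, v) \<in> parcs G. path_image (\<gamma> u v))"

text \<open>
  The drawing of a finite graph is compact, so the complement of the drawing has exactly one
  unbounded component, its \<open>outside\<close>; this is the outer face.
\<close>

definition outerplanar :: "'a pair_pre_digraph \<Rightarrow> bool" where
  "outerplanar G \<longleftrightarrow>
     (\<exists>p \<gamma>. plane_drawing G p \<gamma> \<and>
        (\<forall>v \<in> pverts G. p v \<in> frontier (outside (drawing_points G p \<gamma>))))"


section \<open>The eleven graphs\<close>

definition contains_spanning_copy :: "'a pair_pre_digraph \<Rightarrow> 'b pair_pre_digraph \<Rightarrow> bool" where
  "contains_spanning_copy G T \<longleftrightarrow>
     (\<exists>S. pair_graph S \<and> spanning (with_proj S) (with_proj G) \<and>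
        digraph_iso (with_proj S) (with_proj T))"

definition graph_on :: "'a set \<Rightarrow> 'a rel \<Rightarrow> 'a pair_pre_digraph" where
  "graph_on V E = \<lparr>pverts = V, parcs = E \<union> E\<inverse>\<rparr>"

definition graph_a :: "nat pair_pre_digraph" where
  "graph_a = graph_on {0} {}"

definition graph_b :: "nat pair_pre_digraph" where
  "graph_b = graph_on {0, 1} {(0, 1)}"

definition graph_c :: "nat pair_pre_digraph" where
  "graph_c = graph_on {0, 1, 2} {(0, 1), (1, 2)}"

definition graph_d :: "nat pair_pre_digraph" where
  "graph_d = graph_on {0, 1, 2, 3} {(0, 1), (1, 2), (2, 3), (3, 0)}"

text \<open>\<open>p, q, r, s = 0, 1, 2, 3\<close>\<close>

definition graph_e :: "nat pair_pre_digraph" where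
  "graph_e = graph_on {0, 1, 2, 3} {(0, 1), (1, 2), (0, 2), (2, 3)}"

definition graph_f :: "nat pair_pre_digraph" where
  "graph_f = graph_on {0, 1, 2, 3, 4} {(0, 1), (1, 2), (2, 3), (3, 4), (4, 0)}"

text \<open>\<open>z = 0\<close>; \<open>p\<^sub>1, p\<^sub>2 = 1, 2\<close>; \<open>q\<^sub>1, q\<^sub>2 = 3, 4\<close>\<close>

definition graph_g :: "nat pair_pre_digraph" where
  "graph_g = graph_on {0, 1, 2, 3, 4} {(0, 1), (0, 2), (0, 3), (0, 4), (1, 2), (3, 4)}"

text \<open>\<open>z, s = 0, 1\<close>; \<open>p\<^sub>1, p\<^sub>2, p\<^sub>3 = 2, 3, 4\<close>\<close>

definition graph_h :: "nat pair_pre_digraph" where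
  "graph_h = graph_on {0, 1, 2, 3, 4} {(0, 1), (0, 2), (0, 3), (0, 4), (2, 3), (3, 4)}"

text \<open>\<open>t, l, r, b = 0, 1, 2, 3\<close>; \<open>l', r' = 4, 5\<close>\<close>

definition graph_i :: "nat pair_pre_digraph" where
  "graph_i = graph_on {0, 1, 2, 3, 4, 5}
     {(0, 1), (1, 3), (3, 2), (2, 0), (1, 4), (4, 3), (3, 5), (5, 2)}"

text \<open>\<open>z = 0\<close>; \<open>p\<^sub>1, p\<^sub>2 = 1, 2\<close>; \<open>q\<^sub>1, q\<^sub>2, q\<^sub>3 = 3, 4, 5\<close>\<close>

definition graph_j :: "nat pair_pre_digraph" where
  "graph_j = graph_on {0, 1, 2, 3, 4, 5}
     {(0, 1), (0, 2), (0, 3), (0, 4), (0, 5), (1, 2), (3, 4), (4, 5)}"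

text \<open>\<open>z = 0\<close>; \<open>p\<^sub>1, p\<^sub>2, p\<^sub>3 = 1, 2, 3\<close>; \<open>q\<^sub>1, q\<^sub>2, q\<^sub>3 = 4, 5, 6\<close>\<close>

definition graph_k :: "nat pair_pre_digraph" where
  "graph_k = graph_on {0, 1, 2, 3, 4, 5, 6}
     {(0, 1), (0, 2), (0, 3), (0, 4), (0, 5), (0, 6), (1, 2), (2, 3), (4, 5), (5, 6)}"

end

(*
  The interiors of the three arcs of a planar theta curve cannot all meet the boundary of the outer
  face: otherwise some point inside one arc would border three faces, against Janiszewski's theorem.
  Hence an outerplanar graph has no K_{2,3} minor, and this is all that is used of outerplanarity.

  An oclique has diameter at most two. If no vertex is universal, then for every vertex v the
  non-neighbours of v form a connected set attached to exactly two neighbours a, b of v; every other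
  neighbour of v is adjacent to exactly one of a, b, and at most one to each. For v of maximum degree
  2, 3 or 4 this yields a spanning C_4 or C_5, a spanning C_5, or the graph (i).

  If z is universal, then G - z has maximum degree two and no cycle of length four or more. Vertices
  of G - z whose arcs to z have the same direction are at distance at most two in G - z. So G - z is
  spanned by one path with at most six vertices or by two paths with at most three vertices each.
*)

theory Submission
  imports Defs
begin

section \<open>Ocliques and spanning copies\<close>

text \<open>Surplus edges may be directed at will, so it suffices to orient some of the edges; this
  is why the answer is a list of spanning subgraphs. Without a universal vertex the directions can
  be forgotten: diameter two and the excluded minor already decide. A universal vertex
  \<open>z\<close> makes diameter two vacuous, and there directions matter. A directed path with
  middle vertex \<open>z\<close> joins only a vertex with its arc into \<open>z\<close> to a vertex
  with its arc out of \<open>z\<close>. So G - z splits into two classes, and two vertices of one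
  class must be joined without the help of \<open>z\<close>. On a path component with seven vertices
  the positions 0, 3 and 6 are pairwise at distance at least three and would need three classes:
  hence six. Vertices in different components of G - z need different classes too, so there are at
  most two components. If there are two, each lies in a single class, so positions 0 and 3 cannot
  both occur: hence three.\<close>

lemma pair_digraph_iff:
  "pair_digraph D \<longleftrightarrow> finite (pverts D) \<and> parcs D \<subseteq> pverts D \<times> pverts D \<and> (\<forall>x. (x, x) \<notin> parcs D)"
proof
  assume "pair_digraph D"
  then interpret pair_digraph D .
  show "finite (pverts D) \<and> parcs D \<subseteq> pverts D \<times> pverts D \<and> (\<forall>x. (x, x) \<notin> parcs D)"
    by (auto dest: in_arcsD1 in_arcsD2 no_loops')
next
  assume D: "finite (pverts D) \<and> parcs D \<subseteq> pverts D \<times> pverts D \<and> (\<forall>x. (x, x) \<notin> parcs D)"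
  then have "finite (parcs D)" by (meson finite_SigmaI finite_subset)
  then show "pair_digraph D"
    using D by unfold_locales auto
qed

lemma pair_graph_iff: "pair_graph G \<longleftrightarrow> pair_digraph G \<and> sym (parcs G)"
proof
  assume "pair_graph G"
  then interpret pair_graph G .
  show "pair_digraph G \<and> sym (parcs G)"
    using arcs_symmetric by (auto simp: sym_def)
next
  assume G: "pair_digraph G \<and> sym (parcs G)"
  then interpret pair_digraph G by blast
  show "pair_graph G"
    using G by unfold_locales (auto simp: symmetric_def)
qed

lemma oriented_graph_iff:
  "oriented_graph D \<longleftrightarrow> finite (pverts D) \<and> parcs D \<subseteq> pverts D \<times> pverts D \<and> asym (parcs D)"
  unfolding oriented_graph_def pair_digraph_iff by (auto dest: asymD)

text \<open>Stated for a bare arc set, so that it also applies to partial orientations; it is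
  monotone in \<open>A\<close>.\<close>

definition dipath_complete :: "'a set \<Rightarrow> 'a rel \<Rightarrow> bool" where
  "dipath_complete V A \<longleftrightarrow> (\<forall>u \<in> V. \<forall>v \<in> V. u \<noteq> v \<longrightarrow>
     (u, v) \<in> A \<or> (v, u) \<in> A \<or> (\<exists>w. (u, w) \<in> A \<and> (w, v) \<in> A \<or> (v, w) \<in> A \<and> (w, u) \<in> A))"

text \<open>The targets in \<open>oriented_chromatic_number\<close> live on natural numbers; the
  copy makes digraphs on other types admissible.\<close>

lemma oriented_graph_nat_copy:
  assumes "oriented_graph D"
  obtains H :: "nat pair_pre_digraph" and g where
    "oriented_graph H" "card (pverts H) = card (pverts D)" "arc_preserving D H g"
proof -
  obtain g :: "'a \<Rightarrow> nat" where g: "inj_on g (pverts D)"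
    using assms finite_imp_inj_to_nat_seg[of "pverts D"] by (auto simp: oriented_graph_iff)
  define H where "H = \<lparr>pverts = g ` pverts D, parcs = map_prod g g ` parcs D\<rparr>"
  have "asym (map_prod g g ` parcs D)"
  proof (rule asymI)
    fix a b assume "(a, b) \<in> map_prod g g ` parcs D"
    then obtain x y where xy: "a = g x" "b = g y" "(x, y) \<in> parcs D" by auto
    show "(b, a) \<notin> map_prod g g ` parcs D"
    proof
      assume "(b, a) \<in> map_prod g g ` parcs D"
      then obtain x' y' where "b = g y'" "a = g x'" "(y', x') \<in> parcs D" by auto
      moreover from this have "x' = x" "y' = y"
        using xy assms inj_onD[OF g] unfolding oriented_graph_iff by blast+
      ultimately show False
        using xy(3) assms unfolding oriented_graph_iff by (blast dest: asymD)
    qed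
  qed
  then have "oriented_graph H"
    using assms unfolding oriented_graph_iff H_def by auto
  moreover have "card (pverts H) = card (pverts D)"
    using g by (simp add: H_def card_image)
  moreover have "arc_preserving D H g"
    by (auto simp: arc_preserving_def H_def intro: rev_image_eqI)
  ultimately show thesis by (rule that)
qed

lemma arc_preserving_comp:
  assumes "arc_preserving D D' f" "arc_preserving D' H g"
  shows "arc_preserving D H (g \<circ> f)"
  using assms unfolding arc_preserving_def by fastforce

text \<open>Identifying the ends of an arc would create a loop in the target, identifying the ends
  of a directed path with two arcs a pair of opposite arcs. Asymmetry of \<open>parcs H\<close>
  excludes both.\<close>

lemma arc_preserving_inj_on:
  assumes "dipath_complete (pverts D) (parcs D)" "oriented_graph H" "arc_preserving D H f"
  shows "inj_on f (pverts D)"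
proof (rule inj_onI, rule ccontr)
  fix u v assume uv: "u \<in> pverts D" "v \<in> pverts D" "f u = f v" "u \<noteq> v"
  have f: "(f x, f y) \<in> parcs H" if "(x, y) \<in> parcs D" for x y
    using assms(3) that by (auto simp: arc_preserving_def)
  have as: "(y, x) \<notin> parcs H" if "(x, y) \<in> parcs H" for x y
    using assms(2) that by (auto simp: oriented_graph_def dest: asymD)
  consider "(u, v) \<in> parcs D" | "(v, u) \<in> parcs D" | w where "(u, w) \<in> parcs D" "(w, v) \<in> parcs D"
    | w where "(v, w) \<in> parcs D" "(w, u) \<in> parcs D"
    using assms(1) uv unfolding dipath_complete_def by blast
  then show False
    by cases (use f as uv(3) in metis)+
qed

text \<open>Completeness makes every arc-preserving map into an oriented graph injective, so no
  target is smaller. Conversely, a pair violating completeness can be identified, which yields a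
  target with one vertex less.\<close>

lemma oclique_iff:
  assumes "oriented_graph D"
  shows "oclique D \<longleftrightarrow> dipath_complete (pverts D) (parcs D)"
proof
  let ?P = "\<lambda>k. \<exists>(H :: nat pair_pre_digraph) f. oriented_graph H \<and> card (pverts H) = k \<and> arc_preserving D H f"
  assume dc: "dipath_complete (pverts D) (parcs D)"
  have "(LEAST k. ?P k) = card (pverts D)"
  proof (rule Least_equality)
    show "?P (card (pverts D))"
      using oriented_graph_nat_copy[OF assms] by metis
  next
    fix k assume "?P k"
    then obtain H :: "nat pair_pre_digraph" and f
      where H: "oriented_graph H" "card (pverts H) = k" "arc_preserving D H f" by blast
    have "f ` pverts D \<subseteq> pverts H" using H(3) by (auto simp: arc_preserving_def)
    then show "card (pverts D) \<le> k"
      using card_inj_on_le[OF arc_preserving_inj_on[OF dc H(1,3)]] H(1,2) by (auto simp: oriented_graph_iff)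
  qed
  then show "oclique D"
    using assms by (simp add: oclique_def oriented_chromatic_number_def)
next
  let ?P = "\<lambda>k. \<exists>(H :: nat pair_pre_digraph) f. oriented_graph H \<and> card (pverts H) = k \<and> arc_preserving D H f"
  assume oc: "oclique D"
  show "dipath_complete (pverts D) (parcs D)"
  proof (rule ccontr)
    assume "\<not> dipath_complete (pverts D) (parcs D)"
    then obtain u v where uv: "u \<in> pverts D" "v \<in> pverts D" "u \<noteq> v" "(u, v) \<notin> parcs D" "(v, u) \<notin> parcs D"
      and no2: "\<And>w. (u, w) \<in> parcs D \<Longrightarrow> (w, v) \<notin> parcs D" "\<And>w. (v, w) \<in> parcs D \<Longrightarrow> (w, u) \<notin> parcs D"
      unfolding dipath_complete_def by blast
    have D: "finite (pverts D)" "parcs D \<subseteq> pverts D \<times> pverts D" "asym (parcs D)"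
      using assms by (auto simp: oriented_graph_iff)
    have as: "(y, x) \<notin> parcs D" if "(x, y) \<in> parcs D" for x y
      using D(3) that by (auto dest: asymD)
    \<comment> \<open>Folding \<open>v\<close> onto \<open>u\<close>: opposite arcs in the image
      could only come from an arc between \<open>u\<close> and \<open>v\<close> or from a directed
      path with two arcs between them.\<close>
    define f where "f x = (if x = v then u else x)" for x
    define D' where "D' = \<lparr>pverts = pverts D - {v}, parcs = map_prod f f ` parcs D\<rparr>"
    have asy: "asym (map_prod f f ` parcs D)"
    proof (rule asymI)
      fix a b assume "(a, b) \<in> map_prod f f ` parcs D"
      then obtain x y where xy: "a = f x" "b = f y" "(x, y) \<in> parcs D" by auto
      show "(b, a) \<notin> map_prod f f ` parcs D"
      proof
        assume "(b, a) \<in> map_prod f f ` parcs D"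
        then obtain y' x' where x'y': "b = f y'" "a = f x'" "(y', x') \<in> parcs D" by auto
        have "x' = x \<or> x = u \<and> x' = v \<or> x = v \<and> x' = u" "y' = y \<or> y = u \<and> y' = v \<or> y = v \<and> y' = u"
          using xy(1,2) x'y'(1,2) by (auto simp: f_def split: if_splits)
        then show False
          using xy(3) x'y'(3) no2 uv(4,5) by (elim disjE) (auto dest: as)
      qed
    qed
    have fD: "f x \<in> pverts D - {v}" if "x \<in> pverts D" for x
      using that uv by (simp add: f_def)
    have fA: "(f x, f y) \<in> map_prod f f ` parcs D" if "(x, y) \<in> parcs D" for x y
      using imageI[OF that, of "map_prod f f"] by simp
    have "map_prod f f ` parcs D \<subseteq> (pverts D - {v}) \<times> (pverts D - {v})"
      using D(2) fD by fastforce
    then have "oriented_graph D'"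
      using D(1) asy unfolding oriented_graph_iff D'_def by simp
    then obtain H :: "nat pair_pre_digraph" and g where
      H: "oriented_graph H" "card (pverts H) = card (pverts D')" "arc_preserving D' H g"
      by (rule oriented_graph_nat_copy)
    have "arc_preserving D D' f"
      unfolding arc_preserving_def D'_def using fD fA by auto
    then have "?P (card (pverts D'))"
      using H arc_preserving_comp by blast
    then have "oriented_chromatic_number D \<le> card (pverts D')"
      unfolding oriented_chromatic_number_def by (rule Least_le)
    moreover have "card (pverts D') < card (pverts D)"
      using card_Diff1_less[OF D(1) uv(2)] unfolding D'_def by simp
    ultimately show False
      using oc by (simp add: oclique_def)
  qed
qed

lemma orientation_of_iff:
  "orientation_of G D \<longleftrightarrow> oriented_graph D \<and> pverts D = pverts G \<and> parcs D \<union> (parcs D)\<inverse> = parcs G"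
proof -
  have "(\<Union>e\<in>parcs D. {(fst e, snd e), (snd e, fst e)}) = parcs D \<union> (parcs D)\<inverse>"
    by force
  then show ?thesis
    unfolding orientation_of_def mk_symmetric_def by (cases G) auto
qed

text \<open>Adding arcs preserves \<open>dipath_complete\<close>, so any completion of a partial
  orientation will do.\<close>

lemma orientable_as_oclique_iff:
  assumes G: "pair_graph G"
  shows "orientable_as_oclique G \<longleftrightarrow> (\<exists>A. A \<subseteq> parcs G \<and> asym A \<and> dipath_complete (pverts G) A)"
proof
  assume "orientable_as_oclique G"
  then obtain D where D: "oriented_graph D" "pverts D = pverts G" "parcs D \<union> (parcs D)\<inverse> = parcs G" "oclique D"
    by (auto simp: orientable_as_oclique_def orientation_of_iff)
  then show "\<exists>A. A \<subseteq> parcs G \<and> asym A \<and> dipath_complete (pverts G) A"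
    using oclique_iff[OF D(1)] by (intro exI[of _ "parcs D"]) (auto simp: oriented_graph_iff)
next
  assume "\<exists>A. A \<subseteq> parcs G \<and> asym A \<and> dipath_complete (pverts G) A"
  then obtain A where A: "A \<subseteq> parcs G" "asym A" "dipath_complete (pverts G) A" by blast
  have G': "finite (pverts G)" "parcs G \<subseteq> pverts G \<times> pverts G" "\<And>x. (x, x) \<notin> parcs G" "sym (parcs G)"
    using G by (auto simp: pair_graph_iff pair_digraph_iff)
  obtain g :: "'a \<Rightarrow> nat" where g: "inj_on g (pverts G)"
    using G'(1) finite_imp_inj_to_nat_seg[of "pverts G"] by auto
  \<comment> \<open>Edges left open by \<open>A\<close> are directed towards the larger number under
    the injection \<open>g\<close>.\<close>
  define B where "B = A \<union> {(u, v) \<in> parcs G. (v, u) \<notin> A \<and> g u < g v}"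
  define D where "D = \<lparr>pverts = pverts G, parcs = B\<rparr>"
  have "asym B"
    using asymD[OF A(2)] unfolding B_def by (intro asymI) auto
  then have D: "oriented_graph D"
    using A G' unfolding oriented_graph_iff D_def B_def by auto
  have "(u, v) \<in> B \<or> (v, u) \<in> B" if "(u, v) \<in> parcs G" for u v
  proof -
    have "u \<in> pverts G" "v \<in> pverts G" "u \<noteq> v" using that G' by auto
    then have "g u \<noteq> g v" using inj_onD[OF g] by blast
    then show ?thesis using that symD[OF G'(4) that] unfolding B_def by auto
  qed
  moreover have "B \<subseteq> parcs G" using A(1) unfolding B_def by auto
  ultimately have "B \<union> B\<inverse> = parcs G"
    using symD[OF G'(4)] by auto
  then have "orientation_of G D"
    using D by (auto simp: orientation_of_iff D_def)
  moreover have "dipath_complete (pverts G) B"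
    using A(3) unfolding dipath_complete_def B_def by blast
  then have "oclique D"
    using oclique_iff[OF D] by (simp add: D_def)
  ultimately show "orientable_as_oclique G"
    by (auto simp: orientable_as_oclique_def)
qed

section \<open>Spanning copies as arc-preserving bijections\<close>

lemma wf_with_proj: "pair_digraph D \<Longrightarrow> wf_digraph (with_proj D)"
  unfolding wf_digraph_wp_iff by (simp add: pair_digraph.pair_wf_digraph)

lemma contains_spanning_copyD:
  assumes "contains_spanning_copy G T"
  obtains f where "bij_betw f (pverts T) (pverts G)" "\<And>u v. (u, v) \<in> parcs T \<Longrightarrow> (f u, f v) \<in> parcs G"
proof -
  obtain S h where S: "pair_graph S" "spanning (with_proj S) (with_proj G)"
    and h: "pre_digraph.digraph_isomorphism (with_proj S) h" "with_proj T = app_iso h (with_proj S)"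
    using assms unfolding contains_spanning_copy_def digraph_iso_def by blast
  have SG: "pverts S = pverts G" "parcs S \<subseteq> parcs G"
    using S(2) by (auto simp: spanning_def subgraph_def)
  have T: "pverts T = iso_verts h ` pverts S" "parcs T = iso_arcs h ` parcs S"
    "iso_tail h = fst" "iso_head h = snd"
    using h(2) by (auto simp: with_proj_def app_iso_def)
  \<comment> \<open>A digraph isomorphism carries a separate map on arcs. Tail and head in
    \<open>with_proj T\<close> are the projections, so this map is determined by the vertex
    map.\<close>
  have inj: "inj_on (iso_verts h) (pverts S)"
    and ends: "\<And>e. e \<in> parcs S \<Longrightarrow> iso_verts h (fst e) = fst (iso_arcs h e) \<and> iso_verts h (snd e) = snd (iso_arcs h e)"
    using h(1) T(3,4) by (auto simp: pre_digraph.digraph_isomorphism_def)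
  have SV: "parcs S \<subseteq> pverts S \<times> pverts S"
    using S(1) by (auto simp: pair_graph_iff pair_digraph_iff)
  define f where "f = the_inv_into (pverts S) (iso_verts h)"
  have fh: "f (iso_verts h x) = x" if "x \<in> pverts S" for x
    using the_inv_into_f_f[OF inj that] by (simp add: f_def)
  show thesis
  proof (rule that[of f])
    show "bij_betw f (pverts T) (pverts G)"
      unfolding f_def T(1) SG(1)[symmetric] using inj by (simp add: bij_betw_the_inv_into inj_on_imp_bij_betw)
    fix u v assume "(u, v) \<in> parcs T"
    then obtain x y where e: "(x, y) \<in> parcs S" "iso_arcs h (x, y) = (u, v)"
      using T(2) by auto
    then have "u = iso_verts h x" "v = iso_verts h y" using ends[OF e(1)] by auto
    moreover have "x \<in> pverts S" "y \<in> pverts S" using e(1) SV by auto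
    ultimately show "(f u, f v) \<in> parcs G"
      using e(1) SG(2) fh by auto
  qed
qed

lemma contains_spanning_copyI:
  assumes G: "pair_graph G" and T: "pair_graph T"
    and f: "bij_betw f (pverts T) (pverts G)" "\<And>u v. (u, v) \<in> parcs T \<Longrightarrow> (f u, f v) \<in> parcs G"
  shows "contains_spanning_copy G T"
proof -
  have T': "finite (pverts T)" "parcs T \<subseteq> pverts T \<times> pverts T" "\<And>x. (x, x) \<notin> parcs T" "sym (parcs T)"
    using T by (auto simp: pair_graph_iff pair_digraph_iff)
  have G': "finite (pverts G)" "parcs G \<subseteq> pverts G \<times> pverts G" "\<And>x. (x, x) \<notin> parcs G" "sym (parcs G)"
    using G by (auto simp: pair_graph_iff pair_digraph_iff)
  define S where "S = \<lparr>pverts = pverts G, parcs = map_prod f f ` parcs T\<rparr>"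
  define g where "g = the_inv_into (pverts T) f"
  define h :: "('a, 'a \<times> 'a, 'b, 'b \<times> 'b) digraph_isomorphism" where
    "h = \<lparr>iso_verts = g, iso_arcs = map_prod g g, iso_head = snd, iso_tail = fst\<rparr>"
  have injf: "inj_on f (pverts T)" "f ` pverts T = pverts G" using f(1) by (auto simp: bij_betw_def)
  have gf: "g (f x) = x" if "x \<in> pverts T" for x
    using the_inv_into_f_f[OF injf(1) that] by (simp add: g_def)
  have sub: "parcs S \<subseteq> parcs G" using f(2) by (auto simp: S_def)
  have "sym (parcs S)"
    using T'(4) by (auto simp: S_def sym_def intro: rev_image_eqI)
  then have S: "pair_graph S"
    using sub G' by (auto simp: pair_graph_iff pair_digraph_iff S_def)
  have "spanning (with_proj S) (with_proj G)"
    using S G sub unfolding spanning_def subgraph_def compatible_def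
    by (auto simp: pair_graph_iff wf_with_proj S_def)
  moreover have "pre_digraph.digraph_isomorphism (with_proj S) h"
  proof -
    have "bij_betw g (pverts G) (pverts T)"
      using f(1) by (simp add: g_def bij_betw_the_inv_into)
    then have g: "inj_on g (pverts G)" by (simp add: bij_betw_def)
    moreover have "inj_on (map_prod g g) (parcs S)"
      using map_prod_inj_on[OF g g] sub G'(2) by (meson inj_on_subset subset_trans)
    ultimately show ?thesis
      using S by (auto simp: pre_digraph.digraph_isomorphism_def h_def pair_graph_iff wf_with_proj S_def)
  qed
  moreover have "with_proj T = app_iso h (with_proj S)"
  proof -
    have "g ` pverts G = pverts T"
      using gf injf(2) by force
    moreover have "map_prod g g ` (map_prod f f ` parcs T) = parcs T"
    proof -
      have "map_prod g g (map_prod f f e) = e" if "e \<in> parcs T" for e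
        using that T'(2) gf by (cases e) auto
      then show ?thesis by (force simp: image_image)
    qed
    ultimately show ?thesis
      by (simp add: app_iso_def h_def S_def with_proj_def)
  qed
  ultimately show ?thesis
    using S unfolding contains_spanning_copy_def digraph_iso_def by blast
qed

lemma orientable_if_contains_spanning_copy:
  assumes G: "pair_graph G" and c: "contains_spanning_copy G T"
    and A: "A \<subseteq> parcs T" "parcs T \<subseteq> pverts T \<times> pverts T" "asym A" "dipath_complete (pverts T) A"
  shows "orientable_as_oclique G"
proof -
  obtain f where f: "bij_betw f (pverts T) (pverts G)" "\<And>u v. (u, v) \<in> parcs T \<Longrightarrow> (f u, f v) \<in> parcs G"
    using contains_spanning_copyD[OF c] by blast
  have inj: "f x = f y \<longleftrightarrow> x = y" if "x \<in> pverts T" "y \<in> pverts T" for x y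
    using f(1) that by (auto simp: bij_betw_def dest: inj_onD)
  have "map_prod f f ` A \<subseteq> parcs G" using f(2) A(1) by auto
  moreover have "asym (map_prod f f ` A)"
  proof (rule asymI)
    fix a b assume "(a, b) \<in> map_prod f f ` A"
    then obtain x y where xy: "a = f x" "b = f y" "(x, y) \<in> A" by auto
    show "(b, a) \<notin> map_prod f f ` A"
    proof
      assume "(b, a) \<in> map_prod f f ` A"
      then obtain x' y' where x'y': "b = f y'" "a = f x'" "(y', x') \<in> A" by auto
      have "x \<in> pverts T" "y \<in> pverts T" "x' \<in> pverts T" "y' \<in> pverts T"
        using xy(3) x'y'(3) A(1,2) by auto
      then have "x' = x" "y' = y"
        using xy(1,2) x'y'(1,2) inj by auto
      then show False
        using xy(3) x'y'(3) asymD[OF A(3)] by blast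
    qed
  qed
  moreover have "dipath_complete (pverts G) (map_prod f f ` A)"
    unfolding dipath_complete_def
  proof (intro ballI impI)
    fix u v assume "u \<in> pverts G" "v \<in> pverts G" "u \<noteq> v"
    then obtain x y where xy: "u = f x" "v = f y" "x \<in> pverts T" "y \<in> pverts T" "x \<noteq> y"
      using f(1) unfolding bij_betw_def by blast
    have im: "(f p, f q) \<in> map_prod f f ` A" if "(p, q) \<in> A" for p q
      using that by (auto intro: rev_image_eqI)
    show "(u, v) \<in> map_prod f f ` A \<or> (v, u) \<in> map_prod f f ` A \<or>
      (\<exists>w. (u, w) \<in> map_prod f f ` A \<and> (w, v) \<in> map_prod f f ` A \<or>
        (v, w) \<in> map_prod f f ` A \<and> (w, u) \<in> map_prod f f ` A)"
      using A(4) xy im unfolding dipath_complete_def by meson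
  qed
  ultimately show ?thesis
    using orientable_as_oclique_iff[OF G] by blast
qed

section \<open>Theta curves in the plane\<close>

text \<open>If the interiors met, each would contain the other; the curves, being the frontiers of
  equal interiors, would coincide.\<close>

lemma inside_jordan_disjoint:
  fixes J K :: "real \<Rightarrow> complex"
  assumes J: "simple_path J" "pathfinish J = pathstart J"
    and K: "simple_path K" "pathfinish K = pathstart K"
    and JK: "inside (path_image J) \<inter> path_image K = {}" "inside (path_image K) \<inter> path_image J = {}"
    and ne: "path_image J \<noteq> path_image K"
  shows "inside (path_image J) \<inter> inside (path_image K) = {}"
proof (rule ccontr)
  assume i: "inside (path_image J) \<inter> inside (path_image K) \<noteq> {}"
  \<comment> \<open>The interior of \<open>B\<close> is connected and misses the curve
    \<open>A\<close>, so it lies on one side of \<open>A\<close>.\<close>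
  have sub: "inside (path_image B) \<subseteq> inside (path_image A)"
    if A: "simple_path A" "pathfinish A = pathstart A" and B: "simple_path B" "pathfinish B = pathstart B"
      and d: "inside (path_image B) \<inter> path_image A = {}"
      and m: "inside (path_image A) \<inter> inside (path_image B) \<noteq> {}" for A B :: "real \<Rightarrow> complex"
  proof -
    have *: "open (inside (path_image A))" "open (outside (path_image A))"
      using Jordan_inside_outside[OF A] by blast+
    have "Topological_Spaces.connected (inside (path_image B))"
      using Jordan_inside_outside[OF B] by blast
    moreover have "inside (path_image B) \<subseteq> inside (path_image A) \<union> outside (path_image A)"
      using d by (simp add: disjoint_eq_subset_Compl)
    ultimately show ?thesis
      using connectedD[OF _ *] m inside_Int_outside[of "path_image A"] by blast
  qed
  have "inside (path_image K) \<subseteq> inside (path_image J)"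
    by (rule sub[OF J K JK(2) i])
  moreover have "inside (path_image J) \<subseteq> inside (path_image K)"
    by (rule sub[OF K J JK(1)]) (use i in blast)
  ultimately have "frontier (inside (path_image K)) = frontier (inside (path_image J))"
    by (metis subset_antisym)
  moreover have "frontier (inside (path_image J)) = path_image J" "frontier (inside (path_image K)) = path_image K"
    using Jordan_inside_outside[OF J] Jordan_inside_outside[OF K] by blast+
  ultimately show False
    using ne by simp
qed

text \<open>The set \<open>S\<close> below is the theta graph with a small piece of \<open>c\<^sub>3\<close> around \<open>v\<close> removed.\<close>

lemma theta_interior_point_not_on_three_faces:
  fixes c1 c2 c3 :: "real \<Rightarrow> complex"
  assumes "path c1" "path c2" and c3: "arc c3"
    and ends: "pathstart c2 = pathstart c3" "pathfinish c2 = pathfinish c3"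
    and c12: "{pathstart c3, pathfinish c3} \<subseteq> path_image c1 \<inter> path_image c2"
    and c13: "path_image c1 \<inter> path_image c3 \<subseteq> {pathstart c3, pathfinish c3}"
    and c23: "path_image c2 \<inter> path_image c3 \<subseteq> {pathstart c3, pathfinish c3}"
    and con: "Topological_Spaces.connected (outside (path_image c2 \<union> path_image c3))"
    and v: "v \<in> path_image c3" "v \<noteq> pathstart c3" "v \<noteq> pathfinish c3"
    and x: "\<And>e. e > 0 \<Longrightarrow> \<exists>x \<in> ball v e. x \<in> inside (path_image c1 \<union> path_image c3) \<and>
              x \<in> outside (path_image c2 \<union> path_image c3)"
    and o: "\<And>e. e > 0 \<Longrightarrow> \<exists>y \<in> ball v e. y \<in> outside (path_image c1 \<union> path_image c2 \<union> path_image c3)"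
  shows False
proof -
  obtain t where t: "v = c3 t" "0 \<le> t" "t \<le> 1"
    using v(1) by (auto simp: path_image_def)
  have t01: "0 < t" "t < 1"
    using t v by (auto simp: pathstart_def pathfinish_def less_le)
  have inj: "inj_on c3 {0..1}" and cont: "continuous_on {0..1} c3"
    using c3 by (auto simp: arc_def path_def)
  \<comment> \<open>The parameters \<open>t/2\<close> and \<open>(t+1)/2\<close> bound a gap around
    \<open>t\<close>; any gap that keeps both ends of \<open>c3\<close> would serve.\<close>
  define U where "U = c3 ` {0..t/2}"
  define W where "W = c3 ` {(t+1)/2..1}"
  define S where "S = path_image c1 \<union> (path_image c2 \<union> U \<union> W)"
  define T where "T = path_image c2 \<union> path_image c3"
  have UW: "compact U" "compact W" "Topological_Spaces.connected U" "Topological_Spaces.connected W"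
    unfolding U_def W_def using t01
    by (auto intro!: compact_continuous_image connected_continuous_image continuous_on_subset[OF cont])
  have UWsub: "U \<subseteq> path_image c3" "W \<subseteq> path_image c3"
    unfolding U_def W_def path_image_def using t01 by auto
  have "v \<notin> U" "v \<notin> W"
    unfolding U_def W_def using t t01 by (auto dest!: inj_onD[OF inj])
  then have vS: "v \<notin> S"
    using v c13 c23 by (auto simp: S_def)
  have st: "pathstart c3 \<in> U" "pathfinish c3 \<in> W"
    using t01 by (auto simp: U_def W_def pathstart_def pathfinish_def)
  have cS: "compact S"
    using assms(1,2) UW by (simp add: S_def compact_path_image compact_Un)
  then have "open (- S)"
    by (simp add: compact_imp_closed open_Compl)
  then obtain e where e: "e > 0" "ball v e \<subseteq> - S"
    using vS by (metis ComplI open_contains_ball)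
  obtain x where x': "x \<in> ball v e" "x \<in> inside (path_image c1 \<union> path_image c3)" "x \<in> outside T"
    using x[OF e(1)] by (auto simp: T_def)
  obtain y where y': "y \<in> ball v e" "y \<in> outside (path_image c1 \<union> path_image c2 \<union> path_image c3)"
    using o[OF e(1)] by auto
  have yT: "y \<in> outside T"
    using y'(2) outside_mono[of T "path_image c1 \<union> path_image c2 \<union> path_image c3"] by (auto simp: T_def)
  \<comment> \<open>The two end pieces of \<open>c3\<close> remain attached to \<open>c2\<close>, so
    this intersection is connected, as Janiszewski's theorem demands.\<close>
  have "S \<inter> T = path_image c2 \<union> U \<union> W"
    using c12 c13 UWsub by (auto simp: S_def T_def)
  moreover have "Topological_Spaces.connected (path_image c2 \<union> U \<union> W)"
    using assms(2) UW st c12 by (intro connected_Un) (auto simp: connected_path_image)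
  ultimately have "Topological_Spaces.connected (S \<inter> T)" by simp
  moreover have "closed T"
    using assms(2) c3 by (auto simp: T_def compact_path_image arc_imp_path intro!: compact_imp_closed)
  \<comment> \<open>The connection runs through the gap in \<open>c3\<close>, inside the small ball
    around \<open>v\<close>.\<close>
  moreover have "connected_component (- S) x y"
    using e x' y' by (meson connected_component_of_subset connected_ball connected_component_def order_refl)
  moreover have "connected_component (- T) x y"
    using con x' yT unfolding T_def[symmetric]
    by (metis connected_component_def inside_Un_outside Un_upper2)
  \<comment> \<open>Neither \<open>S\<close> nor \<open>T\<close> separates \<open>x\<close> from
    \<open>y\<close>, hence neither does their union, the whole theta curve. But the loop formed by
    \<open>c1\<close> and \<open>c3\<close> does.\<close>
  ultimately have "connected_component (- (S \<union> T)) x y"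
    using cS by (intro Janiszewski)
  then have "connected_component (- (path_image c1 \<union> path_image c3)) x y"
    by (rule connected_component_of_subset) (auto simp: S_def T_def)
  then have "y \<in> inside (path_image c1 \<union> path_image c3)"
    using x'(2) inside_same_component by blast
  moreover have "y \<in> outside (path_image c1 \<union> path_image c3)"
    using y'(2) outside_mono[of "path_image c1 \<union> path_image c3" "path_image c1 \<union> path_image c2 \<union> path_image c3"]
    by auto
  ultimately show False
    by (meson disjoint_iff inside_Int_outside)
qed

lemma arc_loop:
  assumes "arc c" "arc d" "pathstart c = a" "pathfinish c = b" "pathstart d = a" "pathfinish d = b"
    and "path_image c \<inter> path_image d \<subseteq> {a, b}"
  shows "simple_path (c +++ reversepath d)"
    "pathfinish (c +++ reversepath d) = pathstart (c +++ reversepath d)"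
    "path_image (c +++ reversepath d) = path_image c \<union> path_image d"
  using assms by (auto intro!: simple_path_join_loop simp: arc_reversepath path_image_join)

text \<open>Since \<open>v1\<close> and \<open>v2\<close> are on the outer face, neither
  \<open>c1\<close> nor \<open>c2\<close> runs inside the loop formed by the other one with
  \<open>c3\<close>. The two loops then have disjoint interiors, and \<open>v3\<close> borders both
  of them as well as the outer face.\<close>

lemma theta_interior_points_not_all_outer:
  fixes c1 c2 c3 :: "real \<Rightarrow> complex"
  assumes arcs: "arc c1" "arc c2" "arc c3"
    and s: "pathstart c1 = a" "pathstart c2 = a" "pathstart c3 = a"
    and f: "pathfinish c1 = b" "pathfinish c2 = b" "pathfinish c3 = b"
    and int: "path_image c1 \<inter> path_image c2 \<subseteq> {a, b}" "path_image c1 \<inter> path_image c3 \<subseteq> {a, b}"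
      "path_image c2 \<inter> path_image c3 \<subseteq> {a, b}"
    and v: "v1 \<in> path_image c1 - {a, b}" "v2 \<in> path_image c2 - {a, b}" "v3 \<in> path_image c3 - {a, b}"
    and outer: "{v1, v2, v3} \<subseteq> closure (outside (path_image c1 \<union> path_image c2 \<union> path_image c3))"
  shows False
proof -
  define D where "D = path_image c1 \<union> path_image c2 \<union> path_image c3"
  have ab: "{a, b} \<subseteq> path_image c1" "{a, b} \<subseteq> path_image c2" "{a, b} \<subseteq> path_image c3"
    using s f pathstart_in_path_image[of c1] pathfinish_in_path_image[of c1]
      pathstart_in_path_image[of c2] pathfinish_in_path_image[of c2]
      pathstart_in_path_image[of c3] pathfinish_in_path_image[of c3] by simp_all
  note loop13 = arc_loop[OF arcs(1,3) s(1) f(1) s(3) f(3) int(2)]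
  note loop23 = arc_loop[OF arcs(2,3) s(2) f(2) s(3) f(3) int(3)]
  note J13 = Jordan_inside_outside[OF loop13(1,2), unfolded loop13(3)]
  note J23 = Jordan_inside_outside[OF loop23(1,2), unfolded loop23(3)]
  \<comment> \<open>The point \<open>w\<close> is not inside the loop, because the outside of
    \<open>D\<close> lies outside the loop and \<open>w\<close> is a limit of it. The rest of
    \<open>d\<close> follows \<open>w\<close>, being connected without its ends.\<close>
  have off: "inside (path_image c \<union> path_image c3) \<inter> path_image d = {}"
    if c: "arc d" "path_image c \<union> path_image c3 \<subseteq> D" "pathstart d = a" "pathfinish d = b"
      "path_image d \<inter> (path_image c \<union> path_image c3) \<subseteq> {a, b}" "{a, b} \<subseteq> path_image c3"
      "w \<in> path_image d - {a, b}" "w \<in> closure (outside D)"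
      and J: "open (inside (path_image c \<union> path_image c3))" "open (outside (path_image c \<union> path_image c3))"
    for c d w
  proof -
    let ?J = "path_image c \<union> path_image c3"
    have "closure (outside D) \<subseteq> closure (outside ?J)"
      using c(2) by (intro closure_mono outside_mono)
    then have "w \<notin> inside ?J"
      using c(8) J(1) open_Int_closure_eq_empty[OF J(1)] inside_Int_outside[of ?J] by blast
    moreover have "w \<notin> ?J" using c(5,7) by blast
    ultimately have wo: "w \<in> outside ?J" using inside_Un_outside[of ?J] by blast
    have "Topological_Spaces.connected (path_image d - {a, b})"
      using c(1,3,4) connected_simple_path_endless arc_imp_simple_path by blast
    moreover have "path_image d - {a, b} \<subseteq> inside ?J \<union> outside ?J"
      using c(5) by (auto simp: inside_Un_outside)
    ultimately have "inside ?J \<inter> (path_image d - {a, b}) = {}"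
      using connectedD[OF _ J, of "path_image d - {a, b}"] wo c(7) inside_Int_outside[of ?J] by blast
    moreover have "inside ?J \<inter> {a, b} = {}"
      using c(6) inside_no_overlap[of ?J] by blast
    ultimately show ?thesis by blast
  qed
  have i2: "inside (path_image c1 \<union> path_image c3) \<inter> path_image c2 = {}"
  proof (rule off)
    show "arc c2" "pathstart c2 = a" "pathfinish c2 = b" by fact+
    show "path_image c1 \<union> path_image c3 \<subseteq> D" by (auto simp: D_def)
    show "path_image c2 \<inter> (path_image c1 \<union> path_image c3) \<subseteq> {a, b}" using int by blast
    show "{a, b} \<subseteq> path_image c3" "v2 \<in> path_image c2 - {a, b}" by fact+
    show "v2 \<in> closure (outside D)" using outer by (simp add: D_def)
    show "open (inside (path_image c1 \<union> path_image c3))" "open (outside (path_image c1 \<union> path_image c3))"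
      using J13 by blast+
  qed
  have i1: "inside (path_image c2 \<union> path_image c3) \<inter> path_image c1 = {}"
  proof (rule off)
    show "arc c1" "pathstart c1 = a" "pathfinish c1 = b" by fact+
    show "path_image c2 \<union> path_image c3 \<subseteq> D" by (auto simp: D_def)
    show "path_image c1 \<inter> (path_image c2 \<union> path_image c3) \<subseteq> {a, b}" using int by blast
    show "{a, b} \<subseteq> path_image c3" "v1 \<in> path_image c1 - {a, b}" by fact+
    show "v1 \<in> closure (outside D)" using outer by (simp add: D_def)
    show "open (inside (path_image c2 \<union> path_image c3))" "open (outside (path_image c2 \<union> path_image c3))"
      using J23 by blast+
  qed
  have disj: "inside (path_image c1 \<union> path_image c3) \<inter> inside (path_image c2 \<union> path_image c3) = {}"
  proof (rule inside_jordan_disjoint[OF loop13(1,2) loop23(1,2), unfolded loop13(3) loop23(3)])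
    show "inside (path_image c1 \<union> path_image c3) \<inter> (path_image c2 \<union> path_image c3) = {}"
      using i2 inside_no_overlap[of "path_image c1 \<union> path_image c3"] by blast
    show "inside (path_image c2 \<union> path_image c3) \<inter> (path_image c1 \<union> path_image c3) = {}"
      using i1 inside_no_overlap[of "path_image c2 \<union> path_image c3"] by blast
    show "path_image c1 \<union> path_image c3 \<noteq> path_image c2 \<union> path_image c3"
      using v int by blast
  qed
  show False
  proof (rule theta_interior_point_not_on_three_faces[of c1 c2 c3 v3])
    fix e :: real assume e: "e > 0"
    show "\<exists>y\<in>ball v3 e. y \<in> outside (path_image c1 \<union> path_image c2 \<union> path_image c3)"
      using outer e closure_approachable[of v3] by (metis dist_commute insert_subset mem_ball)
    \<comment> \<open>Near \<open>v3\<close> there are points inside the first loop; keeping away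
      from \<open>c2\<close> ensures that such a point is off the second loop, hence outside
      it.\<close>
    have "v3 \<notin> path_image c2" using v int by blast
    then have "open (ball v3 e - path_image c2)" "v3 \<in> ball v3 e - path_image c2"
      using arcs(2) e by (auto intro!: open_Diff compact_imp_closed compact_path_image arc_imp_path)
    moreover have "v3 \<in> closure (inside (path_image c1 \<union> path_image c3))"
      using J13 v unfolding frontier_def by blast
    ultimately obtain x where x: "x \<in> inside (path_image c1 \<union> path_image c3)" "x \<in> ball v3 e" "x \<notin> path_image c2"
      by (meson DiffD1 DiffD2 closure_iff_nhds_not_empty disjoint_iff order_refl)
    moreover have "x \<notin> path_image c3" using x(1) inside_no_overlap by blast
    ultimately show "\<exists>x\<in>ball v3 e. x \<in> inside (path_image c1 \<union> path_image c3) \<and>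
        x \<in> outside (path_image c2 \<union> path_image c3)"
      using disj inside_Un_outside[of "path_image c2 \<union> path_image c3"] by blast
  next
    show "path c1" "path c2" "arc c3" using arcs by (simp_all add: arc_imp_path)
    show "pathstart c2 = pathstart c3" "pathfinish c2 = pathfinish c3" using s f by simp_all
    show "{pathstart c3, pathfinish c3} \<subseteq> path_image c1 \<inter> path_image c2" using s f ab by simp
    show "path_image c1 \<inter> path_image c3 \<subseteq> {pathstart c3, pathfinish c3}"
      "path_image c2 \<inter> path_image c3 \<subseteq> {pathstart c3, pathfinish c3}" using s f int by simp_all
    show "Topological_Spaces.connected (outside (path_image c2 \<union> path_image c3))" using J23 by blast
    show "v3 \<in> path_image c3" "v3 \<noteq> pathstart c3" "v3 \<noteq> pathfinish c3" using v s f by simp_all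
  qed
qed

section \<open>Drawn paths\<close>

definition vpath :: "('a \<Rightarrow> 'a \<Rightarrow> bool) \<Rightarrow> 'a list \<Rightarrow> bool" where
  "vpath adj xs \<longleftrightarrow> xs \<noteq> [] \<and> distinct xs \<and> successively adj xs"

lemma zip_tl_subset: "(u, v) \<in> set (zip xs (tl xs)) \<Longrightarrow> u \<in> set xs \<and> v \<in> set xs"
  by (cases xs) (auto dest: set_zip_leftD set_zip_rightD)

text \<open>The pairs in \<open>zip xs (tl xs)\<close> are the edges of the path \<open>xs\<close>.
  This shows that a path with an inner vertex shares no edge with another path that it meets only in
  its ends.\<close>

lemma zip_tl_ends:
  assumes "(u, v) \<in> set (zip xs (tl xs))" "distinct xs" "{u, v} \<subseteq> {hd xs, last xs}"
  shows "length xs \<le> 2"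
proof -
  obtain i where i: "u = xs ! i" "v = xs ! Suc i" "Suc i < length xs"
    using assms(1) by (auto simp: in_set_zip nth_tl)
  have "hd xs = xs ! 0" "last xs = xs ! (length xs - 1)"
    using i(3) by (cases xs; simp add: last_conv_nth)+
  moreover have "0 < length xs" "length xs - 1 < length xs" using i(3) by linarith+
  ultimately have "j = 0 \<or> j = length xs - 1" if "xs ! j \<in> {hd xs, last xs}" "j < length xs" for j
    using that assms(2) by (metis insertE nth_eq_iff_index_eq singletonD)
  from this[of i] this[of "Suc i"] show ?thesis
    using assms(3) i by force
qed

lemma plane_drawing_edges_int:
  assumes "plane_drawing G p \<gamma>" "(u, v) \<in> parcs G" "(x, y) \<in> parcs G" "{u, v} \<noteq> {x, y}"
  shows "path_image (\<gamma> u v) \<inter> path_image (\<gamma> x y) \<subseteq> p ` ({u, v} \<inter> {x, y})"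
  using assms unfolding plane_drawing_def by blast

lemma successively_zip_tl: "successively P xs \<Longrightarrow> (u, v) \<in> set (zip xs (tl xs)) \<Longrightarrow> P u v"
  by (induction P xs rule: successively.induct) auto

lemma plane_drawing_path:
  assumes D: "plane_drawing G p \<gamma>"
    and xs: "vpath (\<lambda>u v. (u, v) \<in> parcs G) xs" "length xs \<ge> 2"
  obtains g where "arc g" "pathstart g = p (hd xs)" "pathfinish g = p (last xs)"
    "path_image g = (\<Union>(u, v) \<in> set (zip xs (tl xs)). path_image (\<gamma> u v))"
proof -
  have "\<exists>g. arc g \<and> pathstart g = p (hd xs) \<and> pathfinish g = p (last xs) \<and>
      path_image g = (\<Union>(u, v) \<in> set (zip xs (tl xs)). path_image (\<gamma> u v))"
    using xs
  proof (induction xs)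
    case (Cons u ws)
    then obtain v vs where ws: "ws = v # vs" by (cases ws) auto
    have uv: "(u, v) \<in> parcs G" and dist: "u \<notin> set ws"
      using Cons.prems ws by (auto simp: vpath_def)
    have e: "arc (\<gamma> u v)" "pathstart (\<gamma> u v) = p u" "pathfinish (\<gamma> u v) = p v"
      using D uv unfolding plane_drawing_def by blast+
    show ?case
    proof (cases "vs = []")
      case True
      then show ?thesis using e ws by auto
    next
      case False
      have vws: "vpath (\<lambda>u v. (u, v) \<in> parcs G) ws" "length ws \<ge> 2"
        using Cons.prems False ws by (auto simp: vpath_def Suc_le_eq)
      then obtain g where g: "arc g" "pathstart g = p v" "pathfinish g = p (last ws)"
        "path_image g = (\<Union>(u, v) \<in> set (zip ws (tl ws)). path_image (\<gamma> u v))"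
        using Cons.IH ws by auto
      \<comment> \<open>As \<open>u\<close> does not recur on the path, the new edge meets every
        later edge at most in \<open>p v\<close>, which is what joining arcs requires.\<close>
      have "path_image (\<gamma> u v) \<inter> path_image (\<gamma> x y) \<subseteq> {p v}"
        if "(x, y) \<in> set (zip ws (tl ws))" for x y
      proof -
        have "(x, y) \<in> parcs G"
          using vws(1) that unfolding vpath_def by (blast dest: successively_zip_tl)
        moreover have "x \<noteq> u" "y \<noteq> u" using zip_tl_subset[OF that] dist by auto
        ultimately show ?thesis
          using plane_drawing_edges_int[OF D uv, of x y] by auto
      qed
      then have "path_image (\<gamma> u v) \<inter> path_image g \<subseteq> {pathstart g}"
        unfolding g(2,4) by fast
      then have "arc (\<gamma> u v +++ g)"
        using e g by (intro arc_join) auto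
      then show ?thesis
        using e g ws False by (intro exI[of _ "\<gamma> u v +++ g"]) (auto simp: path_image_join)
    qed
  qed auto
  then show thesis using that by blast
qed

lemma vertex_on_path:
  assumes D: "plane_drawing G p \<gamma>" and "successively (\<lambda>u v. (u, v) \<in> parcs G) xs" "length xs \<ge> 2" "x \<in> set xs"
  shows "p x \<in> (\<Union>(u, v) \<in> set (zip xs (tl xs)). path_image (\<gamma> u v))"
proof -
  have *: "p u \<in> path_image (\<gamma> u v) \<and> p v \<in> path_image (\<gamma> u v)" if "(u, v) \<in> parcs G" for u v
  proof -
    have "pathstart (\<gamma> u v) = p u" "pathfinish (\<gamma> u v) = p v"
      using D that unfolding plane_drawing_def by blast+
    then show ?thesis
      by (metis pathstart_in_path_image pathfinish_in_path_image)
  qed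
  show ?thesis
    using assms(2-4)
  proof (induction xs)
    case (Cons u ws)
    then obtain v vs where ws: "ws = v # vs" by (cases ws) auto
    show ?case
    proof (cases "x = u \<or> x = v")
      case True
      then show ?thesis using *[of u v] Cons.prems ws by auto
    next
      case False
      then have "p x \<in> (\<Union>(u, v) \<in> set (zip ws (tl ws)). path_image (\<gamma> u v))"
        using Cons ws by (cases vs) auto
      then show ?thesis using ws by auto
    qed
  qed auto
qed

text \<open>The paths are drawn as the three arcs of a theta curve, and each of them has an inner
  vertex, which lies on the outer face.\<close>

lemma outerplanar_no_theta:
  assumes G: "pair_graph G" and outer: "outerplanar G"
    and xs: "vpath (\<lambda>u v. (u, v) \<in> parcs G) xs" "length xs \<ge> 3" "hd xs = a" "last xs = b"
    and ys: "vpath (\<lambda>u v. (u, v) \<in> parcs G) ys" "length ys \<ge> 3" "hd ys = a" "last ys = b"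
    and zs: "vpath (\<lambda>u v. (u, v) \<in> parcs G) zs" "length zs \<ge> 3" "hd zs = a" "last zs = b"
    and int: "set xs \<inter> set ys \<subseteq> {a, b}" "set xs \<inter> set zs \<subseteq> {a, b}" "set ys \<inter> set zs \<subseteq> {a, b}"
  shows False
proof -
  let ?adj = "\<lambda>u v. (u, v) \<in> parcs G"
  interpret pair_graph G by fact
  obtain p \<gamma> where D: "plane_drawing G p \<gamma>"
    and fr: "\<And>v. v \<in> pverts G \<Longrightarrow> p v \<in> frontier (outside (drawing_points G p \<gamma>))"
    using outer unfolding outerplanar_def by blast
  define I where "I ws = (\<Union>(u, v) \<in> set (zip ws (tl ws)). path_image (\<gamma> u v))" for ws
  have sub: "I ws \<subseteq> drawing_points G p \<gamma>" if "vpath ?adj ws" for ws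
    using that unfolding I_def vpath_def drawing_points_def by (blast dest: successively_zip_tl)
  have verts: "set ws \<subseteq> pverts G" if "vpath ?adj ws" "length ws \<ge> 3" for ws
  proof
    fix x assume x: "x \<in> set ws"
    then obtain i where i: "i < length ws" "x = ws ! i" by (auto simp: in_set_conv_nth)
    show "x \<in> pverts G"
    proof (cases "Suc i < length ws")
      case True
      then have "(x, ws ! Suc i) \<in> parcs G"
        using that i by (auto simp: vpath_def successively_conv_nth)
      then show ?thesis by (rule in_arcsD1)
    next
      case False
      then have "(ws ! (i - 1), x) \<in> parcs G"
        using that i successively_nth[of ?adj ws "i - 1"] by (auto simp: vpath_def)
      then show ?thesis by (rule in_arcsD2)
    qed
  qed
  have meet: "I ws \<inter> I vs \<subseteq> {p a, p b}"
    if w: "vpath ?adj ws" "length ws \<ge> 3" "hd ws = a" "last ws = b"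
      and v: "vpath ?adj vs" and i: "set ws \<inter> set vs \<subseteq> {a, b}" for ws vs
  proof -
    have "path_image (\<gamma> u v) \<inter> path_image (\<gamma> x y) \<subseteq> {p a, p b}"
      if e: "(u, v) \<in> set (zip ws (tl ws))" "(x, y) \<in> set (zip vs (tl vs))" for u v x y
    proof -
      have arcs: "(u, v) \<in> parcs G" "(x, y) \<in> parcs G"
        using that w v unfolding vpath_def by (blast dest: successively_zip_tl)+
      have uvxy: "{u, v} \<subseteq> set ws" "{x, y} \<subseteq> set vs"
        using e by (auto dest: zip_tl_subset)
      \<comment> \<open>A common edge would join the two ends \<open>a\<close>, \<open>b\<close>,
        which is impossible on a path with at least three vertices.\<close>
      have "{u, v} \<noteq> {x, y}"
      proof
        assume "{u, v} = {x, y}"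
        then have "{u, v} \<subseteq> {hd ws, last ws}" using uvxy i w by auto
        then show False using zip_tl_ends[OF e(1)] w by (auto simp: vpath_def)
      qed
      then have "path_image (\<gamma> u v) \<inter> path_image (\<gamma> x y) \<subseteq> p ` ({u, v} \<inter> {x, y})"
        by (rule plane_drawing_edges_int[OF D arcs])
      also have "\<dots> \<subseteq> p ` {a, b}"
        using uvxy i by (intro image_mono) blast
      finally show ?thesis by simp
    qed
    then show ?thesis unfolding I_def by fast
  qed
  have inner: "\<exists>x \<in> set ws. p x \<in> I ws - {p a, p b} \<and> x \<in> pverts G"
    if w: "vpath ?adj ws" "length ws \<ge> 3" "hd ws = a" "last ws = b" for ws
  proof -
    have "card (set ws) \<ge> 3" using w by (simp add: vpath_def distinct_card)
    have "card (set ws) \<le> 2" if "set ws \<subseteq> {a, b}"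
      using card_mono[OF _ that] by (simp add: card_insert_if split: if_splits)
    then have "\<not> set ws \<subseteq> {a, b}"
      using \<open>card (set ws) \<ge> 3\<close> by auto
    then obtain x where x: "x \<in> set ws" "x \<noteq> a" "x \<noteq> b" by blast
    have ab: "a \<in> set ws" "b \<in> set ws"
      using w by (auto simp: vpath_def)
    have "inj_on p (pverts G)" using D by (simp add: plane_drawing_def)
    then have "p x \<noteq> p a" "p x \<noteq> p b"
      using x ab verts[OF w(1,2)] by (auto dest!: inj_onD)
    moreover have "p x \<in> I ws"
      unfolding I_def using vertex_on_path[OF D _ _ x(1)] w by (auto simp: vpath_def)
    ultimately show ?thesis using x verts[OF w(1,2)] by blast
  qed
  obtain x where x: "p x \<in> I xs - {p a, p b}" "x \<in> pverts G" using inner[OF xs] by blast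
  obtain y where y: "p y \<in> I ys - {p a, p b}" "y \<in> pverts G" using inner[OF ys] by blast
  obtain z where z: "p z \<in> I zs - {p a, p b}" "z \<in> pverts G" using inner[OF zs] by blast
  have "length xs \<ge> 2" "length ys \<ge> 2" "length zs \<ge> 2" using xs ys zs by simp_all
  note len = this
  obtain g1 where g1: "Path_Connected.arc g1" "pathstart g1 = p a" "pathfinish g1 = p b" "path_image g1 = I xs"
    using plane_drawing_path[OF D xs(1) len(1)] xs by (auto simp: I_def)
  obtain g2 where g2: "Path_Connected.arc g2" "pathstart g2 = p a" "pathfinish g2 = p b" "path_image g2 = I ys"
    using plane_drawing_path[OF D ys(1) len(2)] ys by (auto simp: I_def)
  obtain g3 where g3: "Path_Connected.arc g3" "pathstart g3 = p a" "pathfinish g3 = p b" "path_image g3 = I zs"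
    using plane_drawing_path[OF D zs(1) len(3)] zs by (auto simp: I_def)
  \<comment> \<open>Deleting the rest of the drawing only enlarges the outer face, so its old
    boundary stays in the closure.\<close>
  have "frontier (outside (drawing_points G p \<gamma>)) \<subseteq> closure (outside (I xs \<union> I ys \<union> I zs))"
    using sub[OF xs(1)] sub[OF ys(1)] sub[OF zs(1)] closure_mono[OF outside_mono]
    unfolding frontier_def by (metis Diff_subset Un_least subset_trans)
  then have "{p x, p y, p z} \<subseteq> closure (outside (I xs \<union> I ys \<union> I zs))"
    using fr x y z by blast
  then show False
    using theta_interior_points_not_all_outer[OF g1(1) g2(1) g3(1) g1(2) g2(2) g3(2) g1(3) g2(3) g3(3),
        unfolded g1(4) g2(4) g3(4), OF meet[OF xs ys(1) int(1)] meet[OF xs zs(1) int(2)]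
        meet[OF ys zs(1) int(3)] x(1) y(1) z(1)] by blast
qed

section \<open>Connected vertex sets\<close>

definition conn :: "('a \<Rightarrow> 'a \<Rightarrow> bool) \<Rightarrow> 'a set \<Rightarrow> bool" where
  "conn adj C \<longleftrightarrow> C \<noteq> {} \<and> (\<forall>x \<in> C. \<forall>y \<in> C. (\<lambda>u v. u \<in> C \<and> v \<in> C \<and> adj u v)\<^sup>*\<^sup>* x y)"

text \<open>Disjoint \<open>conn\<close> sets are the branch sets of a minor, and
  \<open>touch\<close> gives the edges between them.\<close>

definition touch :: "('a \<Rightarrow> 'a \<Rightarrow> bool) \<Rightarrow> 'a set \<Rightarrow> 'a set \<Rightarrow> bool" where
  "touch adj A B \<longleftrightarrow> (\<exists>a \<in> A. \<exists>b \<in> B. adj a b)"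

lemma conn_singleton [simp]: "conn adj {x}"
  by (simp add: conn_def)

lemma rtranclp_restrict_mono:
  assumes "(\<lambda>u v. u \<in> A \<and> v \<in> A \<and> adj u v)\<^sup>*\<^sup>* x y" "A \<subseteq> B"
  shows "(\<lambda>u v. u \<in> B \<and> v \<in> B \<and> adj u v)\<^sup>*\<^sup>* x y"
  using rtranclp_mono[of "\<lambda>u v. u \<in> A \<and> v \<in> A \<and> adj u v" "\<lambda>u v. u \<in> B \<and> v \<in> B \<and> adj u v"] assms
  by blast

lemma conn_vpath:
  assumes "conn adj C" "x \<in> C" "y \<in> C"
  obtains xs where "vpath adj xs" "hd xs = x" "last xs = y" "set xs \<subseteq> C"
proof -
  have "(\<lambda>u v. u \<in> C \<and> v \<in> C \<and> adj u v)\<^sup>*\<^sup>* x y"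
    using assms by (simp add: conn_def)
  then have "\<exists>xs. vpath adj xs \<and> hd xs = x \<and> last xs = y \<and> set xs \<subseteq> C"
  proof (induction rule: rtranclp_induct)
    case base
    show ?case using assms by (intro exI[of _ "[x]"]) (simp add: vpath_def)
  next
    case (step y z)
    then obtain xs where xs: "vpath adj xs" "hd xs = x" "last xs = y" "set xs \<subseteq> C" by blast
    show ?case
    proof (cases "z \<in> set xs")
      \<comment> \<open>If the path has already visited \<open>z\<close>, it is cut back to that
        visit.\<close>
      case True
      then obtain us ws where "xs = us @ z # ws" by (metis split_list)
      then show ?thesis
        using xs by (intro exI[of _ "us @ [z]"])
          (auto simp: vpath_def successively_append_iff successively_Cons hd_append)
    next
      case False
      then show ?thesis
        using xs step by (intro exI[of _ "xs @ [z]"]) (auto simp: vpath_def successively_append_iff)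
    qed
  qed
  then show thesis using that by blast
qed

section \<open>The excluded minor\<close>

text \<open>The entry \<open>xs ! i\<close> plays vertex \<open>i\<close> of a template graph. Each
  edge is listed in \<open>F\<close> in one direction only, as \<open>adj\<close> will be
  symmetric.\<close>

definition spanned_by :: "'a set \<Rightarrow> ('a \<Rightarrow> 'a \<Rightarrow> bool) \<Rightarrow> nat \<Rightarrow> (nat \<times> nat) set \<Rightarrow> bool" where
  "spanned_by V adj n F \<longleftrightarrow>
     (\<exists>xs. length xs = n \<and> distinct xs \<and> set xs = V \<and> (\<forall>(i, j) \<in> F. adj (xs ! i) (xs ! j)))"

text \<open>All that survives of the topology is \<open>no_theta\<close>, the exclusion of
  subdivisions of K_{2,3}; what follows is purely combinatorial.\<close>

locale theta_free =
  fixes V :: "'a set" and adj :: "'a \<Rightarrow> 'a \<Rightarrow> bool"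
  assumes finite_V: "finite V"
    and adj_V: "adj x y \<Longrightarrow> x \<in> V"
    and adj_sym: "adj x y \<Longrightarrow> adj y x"
    and adj_irrefl: "\<not> adj x x"
    and no_theta: "\<lbrakk>vpath adj xs; length xs \<ge> 3; hd xs = a; last xs = b;
      vpath adj ys; length ys \<ge> 3; hd ys = a; last ys = b;
      vpath adj zs; length zs \<ge> 3; hd zs = a; last zs = b;
      set xs \<inter> set ys \<subseteq> {a, b}; set xs \<inter> set zs \<subseteq> {a, b}; set ys \<inter> set zs \<subseteq> {a, b}\<rbrakk> \<Longrightarrow> False"
begin

lemma adj_commute: "adj x y \<longleftrightarrow> adj y x"
  using adj_sym by blast

lemma adj_V2: "adj x y \<Longrightarrow> y \<in> V"
  using adj_V adj_sym by blast

lemma vpath_rev: "vpath adj (rev xs) \<longleftrightarrow> vpath adj xs"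
proof -
  have "(\<lambda>x y. adj y x) = adj"
    by (intro ext) (rule adj_commute)
  then have "successively (\<lambda>x y. adj y x) xs = successively adj xs"
    by (rule arg_cong)
  then show ?thesis
    by (simp add: vpath_def)
qed

lemma rtranclp_restrict_sym:
  assumes "(\<lambda>u v. u \<in> C \<and> v \<in> C \<and> adj u v)\<^sup>*\<^sup>* x y"
  shows "(\<lambda>u v. u \<in> C \<and> v \<in> C \<and> adj u v)\<^sup>*\<^sup>* y x"
  using assms
proof (induction rule: rtranclp_induct)
  case (step y z)
  have "(\<lambda>u v. u \<in> C \<and> v \<in> C \<and> adj u v) z y"
    using step.hyps(2) by (simp add: adj_sym)
  then show ?case
    using step.IH by (rule converse_rtranclp_into_rtranclp)
qed simp

lemma conn_Un:
  assumes "conn adj A" "conn adj B" "touch adj A B"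
  shows "conn adj (A \<union> B)"
proof -
  let ?R = "\<lambda>u v. u \<in> A \<union> B \<and> v \<in> A \<union> B \<and> adj u v"
  obtain a b where ab: "a \<in> A" "b \<in> B" "adj a b" using assms(3) by (auto simp: touch_def)
  have "?R\<^sup>*\<^sup>* a x" if "x \<in> A \<union> B" for x
  proof (cases "x \<in> A")
    case True
    then show ?thesis
      using assms(1) ab rtranclp_restrict_mono[of A adj a x "A \<union> B"] by (auto simp: conn_def)
  next
    case False
    then have "?R\<^sup>*\<^sup>* b x"
      using assms(2) ab that rtranclp_restrict_mono[of B adj b x "A \<union> B"] by (auto simp: conn_def)
    moreover have "?R a b" using ab by simp
    ultimately show ?thesis by (rule converse_rtranclp_into_rtranclp[rotated])
  qed
  then have "?R\<^sup>*\<^sup>* x y" if "x \<in> A \<union> B" "y \<in> A \<union> B" for x y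
    using that rtranclp_restrict_sym[of "A \<union> B" a x] by (meson rtranclp_trans)
  then show ?thesis
    using assms(1) by (auto simp: conn_def)
qed

lemma conn_insert: "conn adj A \<Longrightarrow> adj x a \<Longrightarrow> a \<in> A \<Longrightarrow> conn adj (insert x A)"
  using conn_Un[of "{x}" A] by (auto simp: touch_def)

lemma conn_set_vpath: "vpath adj xs \<Longrightarrow> conn adj (set xs)"
proof (induction xs)
  case (Cons x xs)
  show ?case
  proof (cases xs)
    case (Cons y ys)
    then show ?thesis
      using Cons.IH Cons.prems conn_insert[of "set xs" x y] by (auto simp: vpath_def)
  qed simp
qed (simp add: vpath_def)

text \<open>Take a path \<open>L\<close> from \<open>p\<close> to \<open>q\<close> and follow a path
  \<open>M\<close> from \<open>r\<close> towards \<open>p\<close>. The hub \<open>h\<close> is the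
  first vertex of \<open>M\<close> on \<open>L\<close>; it exists because \<open>p\<close> is on
  both paths.\<close>

lemma tripod:
  assumes C: "conn adj C" "p \<in> C" "q \<in> C" "r \<in> C"
  obtains h P Q R where
    "vpath adj P" "hd P = h" "last P = p" "set P \<subseteq> C"
    "vpath adj Q" "hd Q = h" "last Q = q" "set Q \<subseteq> C"
    "vpath adj R" "hd R = h" "last R = r" "set R \<subseteq> C"
    "set P \<inter> set Q \<subseteq> {h}" "set P \<inter> set R \<subseteq> {h}" "set Q \<inter> set R \<subseteq> {h}"
proof -
  obtain L where L: "vpath adj L" "hd L = p" "last L = q" "set L \<subseteq> C"
    using conn_vpath[OF C(1-3)] .
  obtain M where M: "vpath adj M" "hd M = r" "last M = p" "set M \<subseteq> C"
    using conn_vpath[OF C(1,4,2)] .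
  have "p \<in> set M" "p \<in> set L"
    using L M hd_in_set[of L] last_in_set[of M] by (auto simp: vpath_def)
  then have "\<exists>x \<in> set M. x \<in> set L" by blast
  from split_list_first_prop[OF this]
  obtain M1 h M2 where M': "M = M1 @ h # M2" "h \<in> set L" "\<forall>x \<in> set M1. x \<notin> set L"
    by blast
  obtain L1 L2 where L': "L = L1 @ h # L2"
    using split_list[OF M'(2)] by blast
  have sub: "vpath adj (L1 @ [h])" "vpath adj (h # L2)" "vpath adj (M1 @ [h])"
    using L(1) M(1) unfolding L' M' vpath_def by (auto simp: successively_append_iff successively_Cons)
  show thesis
  proof (rule that[of "rev (L1 @ [h])" h "h # L2" "rev (M1 @ [h])"])
    show "vpath adj (rev (L1 @ [h]))" "vpath adj (h # L2)" "vpath adj (rev (M1 @ [h]))"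
      using sub unfolding vpath_rev by simp_all
    show "hd (rev (L1 @ [h])) = h" "hd (h # L2) = h" "hd (rev (M1 @ [h])) = h" by simp_all
    show "last (rev (L1 @ [h])) = p" "last (h # L2) = q" "last (rev (M1 @ [h])) = r"
      using L M unfolding L' M'(1) by (auto simp: last_rev hd_append split: if_splits)
    show "set (rev (L1 @ [h])) \<subseteq> C" "set (h # L2) \<subseteq> C" "set (rev (M1 @ [h])) \<subseteq> C"
      using L M unfolding L' M'(1) by auto
    show "set (rev (L1 @ [h])) \<inter> set (h # L2) \<subseteq> {h}"
      using L(1) unfolding L' vpath_def by auto
    show "set (rev (L1 @ [h])) \<inter> set (rev (M1 @ [h])) \<subseteq> {h}" "set (h # L2) \<inter> set (rev (M1 @ [h])) \<subseteq> {h}"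
      using M'(3) unfolding L' by auto
  qed
qed

text \<open>Builds one path of the theta: out along a leg in \<open>A\<close>, across
  \<open>X\<close>, and back along a leg in \<open>B\<close>. Each of the three sets contributes a
  vertex, whence the length.\<close>

lemma bridge_path:
  assumes P: "vpath adj P" "set P \<subseteq> A" and Q: "vpath adj Q" "set Q \<subseteq> B" and X: "conn adj X"
    and disj: "A \<inter> X = {}" "B \<inter> X = {}" "A \<inter> B = {}"
    and x: "adj (last P) x" "x \<in> X" and y: "adj (last Q) y" "y \<in> X"
  obtains W where "vpath adj W" "length W \<ge> 3" "hd W = hd P" "last W = hd Q"
    "set W \<subseteq> set P \<union> X \<union> set Q"
proof -
  obtain L where L: "vpath adj L" "hd L = x" "last L = y" "set L \<subseteq> X"
    using conn_vpath[OF X x(2) y(2)] .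
  have ne: "P \<noteq> []" "Q \<noteq> []" "L \<noteq> []"
    using P Q L by (auto simp: vpath_def)
  show thesis
  proof (rule that[of "P @ L @ rev Q"])
    show "vpath adj (P @ L @ rev Q)"
      unfolding vpath_def
    proof (intro conjI)
      show "distinct (P @ L @ rev Q)"
        using P Q L disj unfolding vpath_def by auto
      have "successively adj (rev Q)"
        using Q vpath_rev[of Q] by (simp add: vpath_def)
      then show "successively adj (P @ L @ rev Q)"
        using P Q L ne x y adj_sym[OF y(1)] unfolding vpath_def
        by (auto simp: successively_append_iff hd_append hd_rev)
    qed (use ne in simp)
    show "length (P @ L @ rev Q) \<ge> 3"
      using ne by (cases P; cases Q; cases L) auto
    show "hd (P @ L @ rev Q) = hd P" "last (P @ L @ rev Q) = hd Q"
      using ne by (auto simp: last_rev)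
    show "set (P @ L @ rev Q) \<subseteq> set P \<union> X \<union> set Q"
      using L by auto
  qed
qed

text \<open>\<open>A\<close> and \<open>B\<close> are the branch sets of the two vertices of degree
  three. Tripods inside them turn the minor into a subdivision, which \<open>no_theta\<close>
  excludes.\<close>

lemma no_K23_minor:
  assumes c: "conn adj A" "conn adj B" "conn adj X" "conn adj Y" "conn adj Z"
    and d: "A \<inter> B = {}" "A \<inter> X = {}" "A \<inter> Y = {}" "A \<inter> Z = {}" "B \<inter> X = {}" "B \<inter> Y = {}" "B \<inter> Z = {}"
      "X \<inter> Y = {}" "X \<inter> Z = {}" "Y \<inter> Z = {}"
    and t: "touch adj A X" "touch adj A Y" "touch adj A Z" "touch adj B X" "touch adj B Y" "touch adj B Z"
  shows False
proof -
  obtain p q r x y z where A: "p \<in> A" "q \<in> A" "r \<in> A"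
    and Ax: "adj p x" "adj q y" "adj r z" "x \<in> X" "y \<in> Y" "z \<in> Z"
    using t(1-3) unfolding touch_def by blast
  obtain p' q' r' x' y' z' where B: "p' \<in> B" "q' \<in> B" "r' \<in> B"
    and Bx: "adj p' x'" "adj q' y'" "adj r' z'" "x' \<in> X" "y' \<in> Y" "z' \<in> Z"
    using t(4-6) unfolding touch_def by blast
  obtain h P Q R where
    P: "vpath adj P" "hd P = h" "last P = p" "set P \<subseteq> A" and
    Q: "vpath adj Q" "hd Q = h" "last Q = q" "set Q \<subseteq> A" and
    R: "vpath adj R" "hd R = h" "last R = r" "set R \<subseteq> A" and
    PQR: "set P \<inter> set Q \<subseteq> {h}" "set P \<inter> set R \<subseteq> {h}" "set Q \<inter> set R \<subseteq> {h}"
    using tripod[OF c(1) A] .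
  obtain h' P' Q' R' where
    P': "vpath adj P'" "hd P' = h'" "last P' = p'" "set P' \<subseteq> B" and
    Q': "vpath adj Q'" "hd Q' = h'" "last Q' = q'" "set Q' \<subseteq> B" and
    R': "vpath adj R'" "hd R' = h'" "last R' = r'" "set R' \<subseteq> B" and
    PQR': "set P' \<inter> set Q' \<subseteq> {h'}" "set P' \<inter> set R' \<subseteq> {h'}" "set Q' \<inter> set R' \<subseteq> {h'}"
    using tripod[OF c(2) B] .
  obtain W1 where W1: "vpath adj W1" "length W1 \<ge> 3" "hd W1 = h" "last W1 = h'" "set W1 \<subseteq> set P \<union> X \<union> set P'"
    using bridge_path[OF P(1,4) P'(1,4) c(3) d(2,5,1), of x x'] P P' Ax Bx by auto
  obtain W2 where W2: "vpath adj W2" "length W2 \<ge> 3" "hd W2 = h" "last W2 = h'" "set W2 \<subseteq> set Q \<union> Y \<union> set Q'"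
    using bridge_path[OF Q(1,4) Q'(1,4) c(4) d(3,6,1), of y y'] Q Q' Ax Bx by auto
  obtain W3 where W3: "vpath adj W3" "length W3 \<ge> 3" "hd W3 = h" "last W3 = h'" "set W3 \<subseteq> set R \<union> Z \<union> set R'"
    using bridge_path[OF R(1,4) R'(1,4) c(5) d(4,7,1), of z z'] R R' Ax Bx by auto
  have cross: "set W \<inter> set W' \<subseteq> {h, h'}"
    if "set W \<subseteq> set S \<union> T \<union> set S'" "set W' \<subseteq> set U \<union> T' \<union> set U'" "set S \<subseteq> A" "set U \<subseteq> A"
      "set S' \<subseteq> B" "set U' \<subseteq> B" "set S \<inter> set U \<subseteq> {h}" "set S' \<inter> set U' \<subseteq> {h'}"
      "A \<inter> T = {}" "A \<inter> T' = {}" "B \<inter> T = {}" "B \<inter> T' = {}" "T \<inter> T' = {}"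
    for W W' S S' T T' U U' using that d(1) by blast
  show False
    by (rule no_theta[OF W1(1-4) W2(1-4) W3(1-4)])
      (rule cross[OF W1(5) W2(5) P(4) Q(4) P'(4) Q'(4) PQR(1) PQR'(1) d(2,3,5,6,8)]
        cross[OF W1(5) W3(5) P(4) R(4) P'(4) R'(4) PQR(2) PQR'(2) d(2,4,5,7,9)]
        cross[OF W2(5) W3(5) Q(4) R(4) Q'(4) R'(4) PQR(3) PQR'(3) d(3,4,6,7,10)])+
qed

abbreviation spans :: "nat \<Rightarrow> (nat \<times> nat) set \<Rightarrow> bool" where
  "spans \<equiv> spanned_by V adj"

lemma spansI:
  assumes "length xs = n" "distinct xs" "set xs = V" "\<And>i j. (i, j) \<in> F \<Longrightarrow> adj (xs ! i) (xs ! j)"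
  shows "spans n F"
  using assms unfolding spanned_by_def by (intro exI[of _ xs]) auto

end

section \<open>Graphs of diameter two without a universal vertex\<close>

locale diam2_theta_free = theta_free +
  assumes diam2: "\<lbrakk>x \<in> V; y \<in> V; x \<noteq> y\<rbrakk> \<Longrightarrow> adj x y \<or> (\<exists>w. adj x w \<and> adj w y)"
begin

definition nbh :: "'a \<Rightarrow> 'a set" where
  "nbh v = {x. adj v x}"

definition far :: "'a \<Rightarrow> 'a set" where
  "far v = V - nbh v - {v}"

definition far_component :: "'a \<Rightarrow> 'a set \<Rightarrow> bool" where
  "far_component v C \<longleftrightarrow> conn adj C \<and> C \<subseteq> far v \<and> (\<forall>x \<in> C. \<forall>y \<in> far v. adj x y \<longrightarrow> y \<in> C)"

text \<open>For a component \<open>C\<close> these are all neighbours of \<open>C\<close> outside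
  \<open>C\<close>, so they separate \<open>C\<close> from the rest of the graph.\<close>

definition att :: "'a \<Rightarrow> 'a set \<Rightarrow> 'a set" where
  "att v C = {x \<in> nbh v. \<exists>c \<in> C. adj x c}"

lemma far_component_exists:
  assumes "w \<in> far v"
  obtains C where "far_component v C" "w \<in> C"
proof -
  let ?R = "\<lambda>x y. x \<in> far v \<and> y \<in> far v \<and> adj x y"
  define C where "C = {x. ?R\<^sup>*\<^sup>* w x}"
  let ?S = "\<lambda>x y. x \<in> C \<and> y \<in> C \<and> adj x y"
  \<comment> \<open>Every vertex met on the way is itself reachable, so reachability inside
    \<open>far v\<close> is reachability inside \<open>C\<close>.\<close>
  have reach: "?S\<^sup>*\<^sup>* w x" if "?R\<^sup>*\<^sup>* w x" for x
    using that
  proof (induction rule: rtranclp_induct)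
    case (step y z)
    then have "?S y z"
      unfolding C_def by (auto intro: rtranclp.rtrancl_into_rtrancl)
    then show ?case
      using step.IH by (rule rtranclp.rtrancl_into_rtrancl[rotated])
  qed simp
  have "?S\<^sup>*\<^sup>* x y" if "x \<in> C" "y \<in> C" for x y
  proof (rule rtranclp_trans)
    have "?R\<^sup>*\<^sup>* w x" "?R\<^sup>*\<^sup>* w y"
      using that by (simp_all add: C_def)
    from this(1) show "?S\<^sup>*\<^sup>* x w"
      by (rule rtranclp_restrict_sym[OF reach])
    from \<open>?R\<^sup>*\<^sup>* w y\<close> show "?S\<^sup>*\<^sup>* w y"
      by (rule reach)
  qed
  moreover have "w \<in> C" by (simp add: C_def)
  moreover have "C \<subseteq> far v"
  proof
    fix x assume "x \<in> C"
    then have "?R\<^sup>*\<^sup>* w x" by (simp add: C_def)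
    then show "x \<in> far v" using assms by (induction rule: rtranclp_induct) auto
  qed
  moreover have "y \<in> C" if "x \<in> C" "y \<in> far v" "adj x y" for x y
  proof -
    have "?R x y" using that \<open>C \<subseteq> far v\<close> by blast
    moreover have "?R\<^sup>*\<^sup>* w x" using that(1) by (simp add: C_def)
    ultimately have "?R\<^sup>*\<^sup>* w y" by (rule rtranclp.rtrancl_into_rtrancl[rotated])
    then show ?thesis by (simp add: C_def)
  qed
  ultimately show thesis
    using that[of C] unfolding far_component_def conn_def by blast
qed

lemma nbr_of_far_component:
  assumes "far_component v C" "w \<in> C" "adj w m"
  shows "m \<in> C \<or> m \<in> att v C"
proof -
  have "w \<in> far v" using assms by (auto simp: far_component_def)
  then have "m \<noteq> v" using assms(3) adj_commute[of w v] by (auto simp: far_def nbh_def)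
  then show ?thesis
    using assms adj_V2[OF assms(3)] adj_commute[of w m]
    by (auto simp: far_component_def far_def att_def)
qed

text \<open>\<open>w\<close> and \<open>y\<close> lie on different sides of the separator
  \<open>att v C\<close>. They are therefore not adjacent, and the common neighbour provided by
  diameter two lies in the separator.\<close>

lemma common_attachment:
  assumes v: "v \<in> V" and C: "far_component v C" "w \<in> C" and y: "y \<in> V" "y \<notin> C" "y \<notin> att v C"
  obtains m where "m \<in> att v C" "adj m w" "adj m y"
proof -
  have "w \<in> V" using C by (auto simp: far_component_def far_def)
  have nadj: "\<not> adj w y"
    using nbr_of_far_component[OF C] y by blast
  then obtain m where m: "adj w m" "adj m y"
    using diam2[OF \<open>w \<in> V\<close> y(1)] y(2) C(2) by blast
  have "m \<notin> C"
    using nbr_of_far_component[OF C(1) _ m(2)] y by blast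
  then have "m \<in> att v C"
    using nbr_of_far_component[OF C m(1)] by blast
  then show thesis
    using that m adj_sym by blast
qed

text \<open>A single attachment would be universal: every vertex of \<open>C\<close> shares it with
  \<open>v\<close>, and every other vertex shares it with \<open>w\<close>. Three attachments,
  between \<open>v\<close> and \<open>C\<close>, would form a K_{2,3} minor.\<close>

lemma att_two:
  assumes v: "v \<in> V" and C: "far_component v C"
    and nouniv: "\<And>x. x \<in> V \<Longrightarrow> \<exists>y \<in> V. y \<noteq> x \<and> \<not> adj x y"
  obtains a b where "a \<noteq> b" "att v C = {a, b}"
proof -
  obtain w where w: "w \<in> C" using C by (auto simp: far_component_def conn_def)
  have vC: "v \<notin> C" "v \<notin> att v C" "nbh v \<inter> C = {}"
    using C by (auto simp: far_component_def far_def att_def nbh_def adj_irrefl)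
  obtain a where a: "a \<in> att v C"
    using common_attachment[OF v C w v vC(1,2)] by blast
  have aV: "a \<in> V" using a adj_V2 by (auto simp: att_def nbh_def)
  have "att v C \<noteq> {a}"
  proof
    assume *: "att v C = {a}"
    obtain y where y: "y \<in> V" "y \<noteq> a" "\<not> adj a y" using nouniv[OF aV] by blast
    show False
    proof (cases "y \<in> C")
      case True
      then show False
        using common_attachment[OF v C True v vC(1,2)] * y by auto
    next
      case False
      then show False
        using common_attachment[OF v C w y(1) False] * y by auto
    qed
  qed
  then obtain b where b: "b \<in> att v C" "b \<noteq> a" using a by blast
  have "c \<in> {a, b}" if c: "c \<in> att v C" for c
  proof (rule ccontr)
    assume asm: "c \<notin> {a, b}"
    show False
      by (rule no_K23_minor[of "{v}" C "{a}" "{b}" "{c}"])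
        (use asm a b c vC C adj_commute adj_irrefl in \<open>auto simp: att_def nbh_def touch_def far_component_def\<close>)
  qed
  then show thesis
    using that[of a b] a b by blast
qed

text \<open>\<open>y\<close> shares an attachment with the vertices of \<open>C\<close>. If
  \<open>y\<close> saw both, then \<open>v\<close>, \<open>y\<close> and \<open>C\<close> would be
  three branch sets between \<open>a\<close> and \<open>b\<close>.\<close>

lemma other_nbrs:
  assumes v: "v \<in> V" and C: "far_component v C" and ab: "att v C = {a, b}" "a \<noteq> b"
  shows "\<And>y. adj v y \<Longrightarrow> y \<noteq> a \<Longrightarrow> y \<noteq> b \<Longrightarrow> adj y a \<noteq> adj y b"
    and "\<And>y z. adj v y \<Longrightarrow> adj v z \<Longrightarrow> y \<notin> {a, b} \<Longrightarrow> z \<notin> {a, b} \<Longrightarrow> adj y a \<Longrightarrow> adj z a \<Longrightarrow> y = z"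
proof -
  obtain w where w: "w \<in> C" using C by (auto simp: far_component_def conn_def)
  have a: "adj v a" "\<exists>c \<in> C. adj a c" and b: "adj v b" "\<exists>c \<in> C. adj b c"
    using ab by (auto simp: att_def nbh_def)
  have vC: "v \<notin> C" "nbh v \<inter> C = {}" and cC: "conn adj C"
    using C by (auto simp: far_component_def far_def)
  show "adj y a \<noteq> adj y b" if y: "adj v y" "y \<noteq> a" "y \<noteq> b" for y
  proof -
    have "y \<notin> C" using y vC by (auto simp: nbh_def)
    moreover have "y \<notin> att v C" using y ab by simp
    ultimately obtain m where "m \<in> att v C" "adj m y"
      using common_attachment[OF v C w adj_V2[OF y(1)]] by blast
    then have "adj y a \<or> adj y b"
      using ab adj_sym by auto
    moreover have False if "adj y a" "adj y b"
      by (rule no_K23_minor[of "{a}" "{b}" "{v}" "{y}" C])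
        (use that a b ab(2) vC y cC adj_commute adj_irrefl in \<open>auto simp: touch_def nbh_def\<close>)
    ultimately show ?thesis by blast
  qed
  show "y = z" if y: "adj v y" "adj v z" "y \<notin> {a, b}" "z \<notin> {a, b}" "adj y a" "adj z a" for y z
  proof (rule ccontr)
    assume "y \<noteq> z"
    \<comment> \<open>Joined to \<open>b\<close>, the component touches \<open>v\<close> through
      \<open>b\<close> and \<open>a\<close> directly, so it is a third branch set between
      \<open>v\<close> and \<open>a\<close> besides \<open>y\<close> and \<open>z\<close>.\<close>
    have bC: "conn adj (insert b C)"
      using b cC by (auto intro: conn_insert)
    show False
      by (rule no_K23_minor[of "{v}" "{a}" "{y}" "{z}" "insert b C"])
        (use bC \<open>y \<noteq> z\<close> a b ab(2) vC y adj_commute adj_irrefl in \<open>auto simp: touch_def nbh_def\<close>)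
  qed
qed

text \<open>Two components share exactly one attachment \<open>a\<close>, and minor exclusion then
  forces \<open>a\<close> to be universal.\<close>

lemma far_component_eq:
  assumes v: "v \<in> V" and C: "far_component v C"
    and nouniv: "\<And>x. x \<in> V \<Longrightarrow> \<exists>y \<in> V. y \<noteq> x \<and> \<not> adj x y"
  shows "C = far v"
proof (rule ccontr)
  assume "C \<noteq> far v"
  then obtain w' where w': "w' \<in> far v" "w' \<notin> C" using C by (auto simp: far_component_def)
  obtain C' where C': "far_component v C'" "w' \<in> C'" using far_component_exists[OF w'(1)] .
  obtain w where w: "w \<in> C" using C by (auto simp: far_component_def conn_def)
  have vC: "v \<notin> C" "nbh v \<inter> C = {}" "conn adj C" "C \<subseteq> V"
    and vC': "v \<notin> C'" "nbh v \<inter> C' = {}" "conn adj C'" "C' \<subseteq> V"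
    using C C' by (auto simp: far_component_def far_def)
  have CC': "C \<inter> C' = {}"
  proof (rule ccontr)
    assume "C \<inter> C' \<noteq> {}"
    then obtain x where x: "x \<in> C" "x \<in> C'" by blast
    have "(\<lambda>u v. u \<in> C' \<and> v \<in> C' \<and> adj u v)\<^sup>*\<^sup>* x w'"
      using C' x by (auto simp: far_component_def conn_def)
    then have "w' \<in> C"
      using x(1) by (induction rule: rtranclp_induct) (use C C' in \<open>auto simp: far_component_def\<close>)
    then show False using w' by simp
  qed
  \<comment> \<open>A common neighbour of vertices in different components must be attached to
    both.\<close>
  have common: "\<exists>m \<in> att v C \<inter> att v C'. adj m x \<and> adj m x'" if x: "x \<in> C" "x' \<in> C'" for x x'
  proof -
    have "x' \<notin> C" "x' \<notin> att v C" "x' \<in> V"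
      using x CC' vC' by (auto simp: att_def)
    then obtain m where m: "m \<in> att v C" "adj m x" "adj m x'"
      using common_attachment[OF v C x(1)] by blast
    then show ?thesis using x by (auto simp: att_def)
  qed
  obtain a where a: "a \<in> att v C" "a \<in> att v C'" using common[OF w C'(2)] by blast
  have two: "\<exists>b. att v D = {a, b} \<and> a \<noteq> b" if D: "far_component v D" "a \<in> att v D" for D
  proof -
    obtain a' b' where *: "a' \<noteq> b'" "att v D = {a', b'}"
      by (rule att_two[OF v D(1) nouniv])
    show ?thesis
    proof (cases "a = a'")
      case True
      then show ?thesis using * by blast
    next
      case False
      then have "a = b'" using * D(2) by blast
      then show ?thesis using * by (intro exI[of _ a']) auto
    qed
  qed
  obtain b where ab: "att v C = {a, b}" "a \<noteq> b" using two[OF C a(1)] by blast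
  obtain c where ac: "att v C' = {a, c}" "a \<noteq> c" using two[OF C'(1) a(2)] by blast
  have va: "adj v a" "\<exists>x \<in> C. adj a x" "\<exists>x \<in> C'. adj a x"
    and vb: "adj v b" "\<exists>x \<in> C. adj b x" and vc: "adj v c" "\<exists>x \<in> C'. adj c x"
    using ab ac by (auto simp: att_def nbh_def)
  have "b \<noteq> c"
  proof
    assume asm: "b = c"
    show False
      by (rule no_K23_minor[of "{a}" "{b}" "{v}" C C'])
        (use asm va vb vc vC vC' CC' ab(2) adj_commute adj_irrefl in \<open>auto simp: touch_def nbh_def\<close>)
  qed
  \<comment> \<open>As \<open>b\<close> and \<open>c\<close> differ, \<open>a\<close> is the only
    attachment common to both components.\<close>
  have aC: "adj a x" if "x \<in> C" for x using common[OF that C'(2)] ab ac \<open>b \<noteq> c\<close> by auto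
  have aC': "adj a x" if "x \<in> C'" for x using common[OF w that] ab ac \<open>b \<noteq> c\<close> by auto
  have cC': "conn adj (insert c C')" using vc vC' by (auto intro: conn_insert)
  \<comment> \<open>Otherwise \<open>C\<close>, \<open>v\<close>, and \<open>C'\<close> together
    with \<open>c\<close> would be three branch sets between \<open>a\<close> and
    \<open>b\<close>.\<close>
  have "\<not> adj b c"
  proof
    assume asm: "adj b c"
    show False
      by (rule no_K23_minor[of "{a}" "{b}" C "{v}" "insert c C'"])
        (use asm cC' va vb vc vC vC' CC' ab(2) ac(2) \<open>b \<noteq> c\<close> adj_commute adj_irrefl in \<open>auto simp: touch_def nbh_def\<close>)
  qed
  \<comment> \<open>With respect to \<open>C\<close>, \<open>c\<close> is a further neighbour of
    \<open>v\<close>, so it sees \<open>a\<close> or \<open>b\<close>; with respect to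
    \<open>C'\<close> the same holds for \<open>b\<close>.\<close>
  then have ba: "adj b a" and ca: "adj c a"
    using other_nbrs(1)[OF v C ab, of c] other_nbrs(1)[OF v C'(1) ac, of b] vb vc ab ac \<open>b \<noteq> c\<close> adj_commute
    by auto
  have N: "y \<in> {a, b, c}" if y: "adj v y" for y
  proof (rule ccontr)
    assume *: "y \<notin> {a, b, c}"
    then have "\<not> adj y a"
      using other_nbrs(2)[OF v C ab y vc(1)] ca ac(2) \<open>b \<noteq> c\<close> by auto
    then have ybc: "adj y b" "adj y c"
      using other_nbrs(1)[OF v C ab y] other_nbrs(1)[OF v C'(1) ac y] * by auto
    show False
      by (rule no_K23_minor[of "{b}" "{c}" "{y}" "{v}" "{a}"])
        (use ybc * va vb vc y ba ca ab(2) ac(2) \<open>b \<noteq> c\<close> adj_commute adj_irrefl in \<open>auto simp: touch_def\<close>)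
  qed
  have "adj a y" if y: "y \<in> V" "y \<noteq> a" for y
  proof (rule ccontr)
    assume nay: "\<not> adj a y"
    then have yC: "y \<notin> C" "y \<notin> C'" using aC aC' by blast+
    have "y \<noteq> v" "y \<noteq> b" "y \<noteq> c" using nay va ba ca adj_commute by blast+
    then have "\<not> adj v y" using N y by blast
    then have yN: "y \<notin> att v C" "y \<notin> att v C'" by (auto simp: att_def nbh_def)
    have yb: "adj b y" using common_attachment[OF v C w y(1) yC(1) yN(1)] ab nay by auto
    have yc: "adj c y" using common_attachment[OF v C' y(1) yC(2) yN(2)] ac nay by auto
    \<comment> \<open>The attachment that \<open>y\<close> shares with \<open>C\<close> can only be
      \<open>b\<close>, and with \<open>C'\<close> only \<open>c\<close>. So \<open>y\<close>,
      \<open>c\<close> and \<open>C'\<close> join up to a branch set between \<open>a\<close> and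
      \<open>b\<close>, besides \<open>C\<close> and \<open>v\<close>.\<close>
    have ycC: "conn adj (insert y (insert c C'))"
      using cC' adj_sym[OF yc] by (auto intro!: conn_insert)
    show False
      by (rule no_K23_minor[of "{a}" "{b}" C "{v}" "insert y (insert c C')"])
        (use yb ycC va vb vc vC vC' CC' ab(2) ac(2) \<open>b \<noteq> c\<close> yC y \<open>y \<noteq> v\<close> \<open>y \<noteq> b\<close> adj_commute adj_irrefl in \<open>auto simp: touch_def nbh_def\<close>)
  qed
  moreover have "a \<in> V" using va adj_V2 by blast
  ultimately show False using nouniv by blast
qed

end

context diam2_theta_free
begin

text \<open>The neighbours of \<open>v\<close> are the attachments \<open>a\<close>,
  \<open>b\<close> and at most one further vertex at each. Maximality of the degree of
  \<open>v\<close> serves to bound the degrees of the attachments when \<open>v\<close> has degree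
  two or three.\<close>

lemma spans_no_universal:
  assumes "V \<noteq> {}" and nouniv: "\<And>x. x \<in> V \<Longrightarrow> \<exists>y \<in> V. y \<noteq> x \<and> \<not> adj x y"
  shows "spans 4 {(0, 1), (1, 2), (2, 3), (3, 0)} \<or> spans 5 {(0, 1), (1, 2), (2, 3), (3, 4), (4, 0)} \<or>
    spans 6 {(0, 1), (1, 3), (3, 2), (2, 0), (1, 4), (4, 3), (3, 5), (5, 2)}" (is "?d \<or> ?f \<or> ?i")
proof -
  have "Max ((\<lambda>v. card (nbh v)) ` V) \<in> (\<lambda>v. card (nbh v)) ` V"
    using finite_V assms(1) by (intro Max_in) auto
  then obtain v where v: "v \<in> V" "card (nbh v) = Max ((\<lambda>v. card (nbh v)) ` V)"
    by auto
  have max: "card (nbh u) \<le> card (nbh v)" if "u \<in> V" for u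
    using that finite_V unfolding v(2) by (intro Max_ge) auto
  have fin: "finite (nbh u)" for u
    using finite_V by (rule finite_subset[rotated]) (auto simp: nbh_def adj_V2)
  obtain u where "u \<in> far v"
    using nouniv[OF v(1)] by (auto simp: far_def nbh_def)
  then obtain C where C: "far_component v C" using far_component_exists by blast
  have W: "far_component v (far v)"
    using C far_component_eq[OF v(1) C nouniv] by simp
  have Wv: "\<not> adj v w" "\<not> adj w v" "w \<noteq> v" if "w \<in> far v" for w
    using that adj_commute by (auto simp: far_def nbh_def)
  have V: "V = insert v (nbh v \<union> far v)"
    using v(1) by (auto simp: far_def nbh_def adj_V2)
  have vN: "v \<notin> nbh v" "v \<notin> far v" by (auto simp: nbh_def adj_irrefl far_def)
  obtain a b where ab: "a \<noteq> b" "att v (far v) = {a, b}"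
    using att_two[OF v(1) W nouniv] .
  have attD: "adj v a" "\<exists>w \<in> far v. adj a w" "adj v b" "\<exists>w \<in> far v. adj b w"
    if "att v (far v) = {a, b}" for a b
    using that by (auto simp: att_def nbh_def)
  have cover: "adj a w \<or> adj b w" if att: "att v (far v) = {a, b}" and w: "w \<in> far v" for a b w
  proof -
    have "v \<notin> att v (far v)" using vN by (simp add: att_def)
    then obtain m where "m \<in> att v (far v)" "adj m w"
      using common_attachment[OF v(1) W w v(1) vN(2)] by blast
    then show ?thesis using att by auto
  qed
  \<comment> \<open>Here \<open>a\<close> is the attachment seen by the third neighbour
    \<open>y\<close>; the two are exchanged at the end if necessary.\<close>
  have main: ?thesis if ab: "a \<noteq> b" "att v (far v) = {a, b}" and y: "adj v y" "y \<notin> {a, b}" "adj y a" for a b y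
  proof -
    note o = other_nbrs[OF v(1) W ab(2,1)]
    have ba: "att v (far v) = {b, a}" using ab(2) by blast
    note o' = other_nbrs[OF v(1) W ba ab(1)[symmetric]]
    note va = attD[OF ab(2)]
    \<comment> \<open>Of the two attachments \<open>z\<close> can see only \<open>c\<close>, so
      \<open>c\<close> is the one that it shares with \<open>w\<close>.\<close>
    have reach: "adj c w" if z: "adj v z" "z \<notin> {c, d}" "\<not> adj z d" "att v (far v) = {c, d}" "w \<in> far v" for z c d w
    proof -
      have "z \<notin> far v" "z \<notin> att v (far v)" using z by (auto simp: far_def nbh_def)
      then obtain m where "m \<in> att v (far v)" "adj m w" "adj m z"
        using common_attachment[OF v(1) W z(5) adj_V2[OF z(1)]] by blast
      then show ?thesis using z adj_commute by auto
    qed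
    have yb: "\<not> adj y b" using o(1)[of y] y by auto
    then have aW: "adj a w" if "w \<in> far v" for w
      using reach[OF y(1,2)] ab(2) that by blast
    obtain w where w: "w \<in> far v" "adj b w" using va by blast
    have ne: "w \<notin> {v, a, b, y}" "v \<notin> {a, b, y}"
      using w va y vN by (auto simp: far_def nbh_def adj_irrefl)
    show ?thesis
    proof (cases "nbh v \<subseteq> {a, b, y}")
      case True
      then have N: "nbh v = {a, b, y}" using va y by (auto simp: nbh_def)
      have sub: "{v, y} \<union> far v \<subseteq> nbh a"
        using va y aW adj_commute by (auto simp: nbh_def)
      \<comment> \<open>A second far vertex \<open>w'\<close> would give \<open>a\<close> the four
        neighbours \<open>v\<close>, \<open>y\<close>, \<open>w\<close>, \<open>w'\<close>, while
        the maximum degree is three.\<close>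
      have "far v = {w}"
      proof (rule ccontr)
        assume "far v \<noteq> {w}"
        then obtain w' where w': "w' \<in> far v" "w' \<noteq> w" using w by blast
        have "w' \<noteq> y" using Wv[OF w'(1)] y by auto
        then have "card {v, y, w, w'} = 4"
          using ne w'(2) Wv[OF w'(1)] by auto
        moreover have "card {v, y, w, w'} \<le> card (nbh a)"
          using sub w w' fin by (intro card_mono) auto
        moreover have "card (nbh a) \<le> 3"
          using max[OF adj_V2[OF va(1)]] N ab(1) y(2) by (auto simp: card_insert_if)
        ultimately show False by simp
      qed
      then have "?f"
        using ne y va ab w aW[OF w(1)] N adj_commute V
        by (intro spansI[of "[v, y, a, w, b]"]) auto
      then show ?thesis by blast
    next
      case False
      then obtain z where z: "adj v z" "z \<notin> {a, b, y}" by (auto simp: nbh_def)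
      have "\<not> adj z a" using o(2)[of y z] y z by blast
      then have zb: "adj z b" using o(1)[of z] z by auto
      have N: "nbh v = {a, b, y, z}"
      proof -
        have "u \<in> {a, b, y, z}" if u: "adj v u" for u
        proof (rule ccontr)
          assume u': "u \<notin> {a, b, y, z}"
          then have "adj u a \<or> adj u b" using o(1)[of u] u by auto
          then show False
            using o(2)[OF u y(1)] o'(2)[OF u z(1)] u' y z zb by auto
        qed
        then show ?thesis using va y z by (auto simp: nbh_def)
      qed
      have bW: "adj b w" if "w \<in> far v" for w
        using reach[of z b a w] z \<open>\<not> adj z a\<close> ba that by auto
      \<comment> \<open>Now all far vertices see both attachments; two of them together with
        \<open>v\<close> would form K_{2,3}.\<close>
      have "far v = {w}"
      proof (rule ccontr)
        assume "far v \<noteq> {w}"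
        then obtain w' where w': "w' \<in> far v" "w' \<noteq> w" using w by blast
        have w'ne: "w' \<notin> {v, a, b}" using w' va vN by (auto simp: far_def nbh_def)
        show False
          by (rule no_K23_minor[of "{a}" "{b}" "{v}" "{w}" "{w'}"])
            (use ab ne w w' w'ne va aW[OF w(1)] aW[OF w'(1)] bW[OF w(1)] bW[OF w'(1)] adj_commute in \<open>auto simp: touch_def\<close>)
      qed
      moreover have wz: "w \<noteq> z" "z \<noteq> v" using z w by (auto simp: far_def nbh_def adj_irrefl)
      \<comment> \<open>\<open>w\<close> and \<open>v\<close> are opposite on the four-cycle through
        \<open>a\<close> and \<open>b\<close>; \<open>y\<close> and \<open>z\<close> are the tips of
        the triangles on \<open>va\<close> and \<open>vb\<close>.\<close>
      ultimately have "?i"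
        using ne y z va ab w aW[OF w(1)] N adj_commute zb V wz
        by (intro spansI[of "[w, a, b, v, y, z]"]) auto
      then show ?thesis by blast
    qed
  qed
  show ?thesis
  proof (cases "nbh v \<subseteq> {a, b}")
    case True
    note va = attD[OF ab(2)]
    have N: "nbh v = {a, b}" using True va by (auto simp: nbh_def)
    obtain w1 where w1: "w1 \<in> far v" "adj a w1" using va by blast
    obtain w2 where w2: "w2 \<in> far v" "adj b w2" using va by blast
    \<comment> \<open>Here the maximum degree is two, so \<open>v\<close> and \<open>w\<close>
      exhaust the neighbours of \<open>c\<close>.\<close>
    have nb: "nbh c = {v, w}" if "adj v c" "w \<in> far v" "adj c w" for c w
    proof -
      have "{v, w} \<subseteq> nbh c" using that adj_commute by (auto simp: nbh_def)
      moreover have "card (nbh c) \<le> card {v, w}"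
        using max[of c] adj_V2[OF that(1)] N ab Wv[OF that(2)] by simp
      ultimately show ?thesis using card_seteq[OF fin] by blast
    qed
    have na: "nbh a = {v, w1}" and nb: "nbh b = {v, w2}"
      using nb va w1 w2 by blast+
    have ne: "w1 \<notin> {v, a, b}" "w2 \<notin> {v, a, b}" "v \<notin> {a, b}"
      using w1 w2 va vN by (auto simp: far_def nbh_def)
    have "w \<in> {w1, w2}" if "w \<in> far v" for w
    proof -
      have "w \<in> nbh a \<union> nbh b" using cover[OF ab(2) that] by (auto simp: nbh_def)
      then show ?thesis using na nb Wv[OF that] by auto
    qed
    then have far: "far v = {w1, w2}" using w1 w2 by blast
    show ?thesis
    proof (cases "w1 = w2")
      case True
      then have "?d"
        using ne va ab w1 w2 N far adj_commute V
        by (intro spansI[of "[v, a, w1, b]"]) auto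
      then show ?thesis by blast
    next
      case False
      have "w2 \<notin> nbh a" using na False ne by auto
      \<comment> \<open>The common neighbour of \<open>a\<close> and \<open>w2\<close> cannot be
        \<open>v\<close>, so it is \<open>w1\<close>, and the cycle closes.\<close>
      then obtain m where "adj a m" "adj m w2"
        using diam2[of a w2] ne w2 adj_V2[OF va(1)] by (auto simp: nbh_def far_def)
      then have "m \<in> {v, w1}" using na by (auto simp: nbh_def)
      then have "adj w1 w2" using \<open>adj m w2\<close> Wv[OF w2(1)] by auto
      then have "?f"
        using ne va ab w1 w2 N far adj_commute V False
        by (intro spansI[of "[v, a, w1, w2, b]"]) auto
      then show ?thesis by blast
    qed
  next
    case False
    then obtain y where y: "adj v y" "y \<notin> {a, b}" by (auto simp: nbh_def)
    then have "adj y a \<or> adj y b"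
      using other_nbrs(1)[OF v(1) W ab(2,1), of y] by auto
    then show ?thesis
      using main[OF ab y] main[of b a y] ab y by (auto simp: insert_commute)
  qed
qed

end

section \<open>Graphs with a universal vertex\<close>

locale universal_theta_free = theta_free +
  fixes z :: 'a
  assumes z_V: "z \<in> V"
    and universal: "\<lbrakk>x \<in> V; x \<noteq> z\<rbrakk> \<Longrightarrow> adj z x"
begin

abbreviation H :: "'a set" where
  "H \<equiv> V - {z}"

text \<open>These are the unions of components of G - z.\<close>

definition nbr_closed :: "'a set \<Rightarrow> bool" where
  "nbr_closed U \<longleftrightarrow> U \<subseteq> H \<and> (\<forall>x \<in> U. \<forall>y \<in> H. adj x y \<longrightarrow> y \<in> U)"

lemma nbr_closedD: "nbr_closed U \<Longrightarrow> x \<in> U \<Longrightarrow> y \<in> H \<Longrightarrow> adj x y \<Longrightarrow> y \<in> U"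
  by (simp add: nbr_closed_def)

text \<open>\<open>x\<close> and \<open>z\<close> would both be adjacent to \<open>p\<close>,
  \<open>q\<close> and \<open>r\<close>.\<close>

lemma degree_le_2:
  assumes "x \<in> H" "p \<in> H" "q \<in> H" "r \<in> H" "adj x p" "adj x q" "adj x r"
    and "p \<noteq> q" "p \<noteq> r" "q \<noteq> r"
  shows False
  by (rule no_K23_minor[of "{x}" "{z}" "{p}" "{q}" "{r}"])
    (use assms universal adj_irrefl in \<open>auto simp: touch_def\<close>)

section \<open>Paths spanning the components of G - z\<close>

lemma maximal_path:
  assumes "S \<subseteq> H" "S \<noteq> {}"
  obtains xs where "vpath adj xs" "set xs \<subseteq> S"
    "\<And>y. y \<in> S \<Longrightarrow> y \<notin> set xs \<Longrightarrow> \<not> adj (hd xs) y \<and> \<not> adj (last xs) y"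
proof -
  let ?P = "\<lambda>xs. vpath adj xs \<and> set xs \<subseteq> S"
  obtain s where "s \<in> S" using assms(2) by blast
  then have "?P [s]" by (simp add: vpath_def)
  moreover have "\<forall>xs. ?P xs \<longrightarrow> length xs < Suc (card S)"
  proof (intro allI impI)
    fix xs assume xs: "?P xs"
    have "finite S" using assms(1) finite_V by (meson finite_Diff finite_subset)
    then have "card (set xs) \<le> card S" using xs by (intro card_mono) auto
    then show "length xs < Suc (card S)" using xs by (simp add: vpath_def distinct_card)
  qed
  ultimately obtain xs where xs: "?P xs" "\<And>ys. ?P ys \<Longrightarrow> length ys \<le> length xs"
    using ex_has_greatest_nat[of ?P "[s]" length "Suc (card S)"] by blast
  show thesis
  proof (rule that[of xs])
    fix y assume y: "y \<in> S" "y \<notin> set xs"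
    have "\<not> ?P (y # xs)" "\<not> ?P (xs @ [y])"
      using xs(2)[of "y # xs"] xs(2)[of "xs @ [y]"] by auto
    then show "\<not> adj (hd xs) y \<and> \<not> adj (last xs) y"
      using xs(1) y adj_sym
      by (auto simp: vpath_def successively_append_iff successively_Cons)
  qed (use xs in auto)
qed

text \<open>The ends have no neighbours off the path by maximality. An inner vertex has two
  neighbours on the path, and \<open>degree_le_2\<close> forbids a third. So the path spans a
  component.\<close>

lemma maximal_path_closed:
  assumes S: "nbr_closed S"
    and xs: "vpath adj xs" "set xs \<subseteq> S"
      "\<And>y. y \<in> S \<Longrightarrow> y \<notin> set xs \<Longrightarrow> \<not> adj (hd xs) y \<and> \<not> adj (last xs) y"
  shows "nbr_closed (set xs)"
proof (rule ccontr)
  have SH: "S \<subseteq> H" using S by (simp add: nbr_closed_def)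
  assume "\<not> nbr_closed (set xs)"
  then obtain x y where xy: "x \<in> set xs" "y \<in> H" "adj x y" and y: "y \<notin> set xs"
    using SH xs(2) by (auto simp: nbr_closed_def)
  obtain i where i: "i < length xs" "x = xs ! i" using xy(1) by (auto simp: in_set_conv_nth)
  have "y \<in> S" using nbr_closedD[OF S _ xy(2,3)] xs(2) xy(1) by blast
  then have "x \<noteq> hd xs" "x \<noteq> last xs" using xs(3) y xy(3) by auto
  then have "i \<noteq> 0" "i \<noteq> length xs - 1"
    using i xs(1) by (intro notI; auto simp: vpath_def hd_conv_nth last_conv_nth)+
  then have ii: "0 < i" "Suc i < length xs" using i by auto
  have suc: "adj (xs ! k) (xs ! Suc k)" if "Suc k < length xs" for k
    using xs(1) that by (simp add: vpath_def successively_nth)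
  have mem: "xs ! k \<in> H" if "k < length xs" for k
    using that xs(2) SH nth_mem by blast
  have "adj (xs ! i) (xs ! (i - 1))" "adj (xs ! i) (xs ! Suc i)"
    using suc[of "i - 1"] suc[of i] ii adj_sym by simp_all
  moreover have "xs ! (i - 1) \<noteq> xs ! Suc i"
    using xs(1) ii by (simp add: vpath_def nth_eq_iff_index_eq)
  moreover have "xs ! (i - 1) \<noteq> y" "xs ! Suc i \<noteq> y"
    using y ii by (metis less_imp_diff_less i(1) nth_mem)+
  moreover have "xs ! i \<in> H" "xs ! (i - 1) \<in> H" "xs ! Suc i \<in> H"
    using mem ii i by simp_all
  ultimately show False
    using degree_le_2[of "xs ! i" "xs ! (i - 1)" "xs ! Suc i" y] xy i by blast
qed

text \<open>A chord at an inner vertex violates \<open>degree_le_2\<close>. A chord between the ends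
  closes a cycle, which with \<open>z\<close> contains a K_{2,3} minor. Four vertices are required
  because three may form a triangle.\<close>

lemma path_induced:
  assumes xs: "vpath adj xs" "set xs \<subseteq> H" "length xs \<ge> 4"
    and ij: "i < j" "j < length xs" "adj (xs ! i) (xs ! j)"
  shows "j = Suc i"
proof (rule ccontr)
  assume ne: "j \<noteq> Suc i"
  let ?n = "length xs"
  have suc: "adj (xs ! k) (xs ! Suc k)" if "Suc k < ?n" for k
    using xs(1) that by (simp add: vpath_def successively_nth)
  have eq: "xs ! k = xs ! l \<longleftrightarrow> k = l" if "k < ?n" "l < ?n" for k l
    using xs(1) that by (simp add: vpath_def nth_eq_iff_index_eq)
  have mem: "xs ! k \<in> H" if "k < ?n" for k
    using that xs(2) nth_mem by blast
  have "i = 0"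
  proof (rule ccontr)
    assume "i \<noteq> 0"
    then have "adj (xs ! i) (xs ! (i - 1))" "adj (xs ! i) (xs ! Suc i)"
      using suc[of "i - 1"] suc[of i] ij adj_sym by simp_all
    moreover have "i - 1 \<noteq> Suc i" "i - 1 \<noteq> j" using ij by linarith+
    ultimately show False
      using degree_le_2[of "xs ! i" "xs ! (i - 1)" "xs ! Suc i" "xs ! j"] ij ne \<open>i \<noteq> 0\<close> mem
      by (simp add: eq)
  qed
  have "j = ?n - 1"
  proof (rule ccontr)
    assume "j \<noteq> ?n - 1"
    then have "Suc j < ?n" using ij by simp
    then have "adj (xs ! j) (xs ! (j - 1))" "adj (xs ! j) (xs ! Suc j)"
      using suc[of "j - 1"] suc[of j] ij adj_sym by simp_all
    moreover have "j - 1 \<noteq> Suc j" "j - 1 \<noteq> i" using ij ne by linarith+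
    ultimately show False
      using degree_le_2[of "xs ! j" "xs ! (j - 1)" "xs ! Suc j" "xs ! i"] ij ne \<open>Suc j < ?n\<close> mem adj_sym[OF ij(3)]
      by (simp add: eq)
  qed
  \<comment> \<open>The cycle minus its first three vertices. The hubs are positions 0 and 2, linked
    through position 1, through \<open>z\<close> and through this remainder.\<close>
  let ?D = "set (drop 3 xs)"
  have "vpath adj (drop 3 xs)"
    using xs successively_append_iff[of adj "take 3 xs" "drop 3 xs"] by (auto simp: vpath_def)
  then have D: "conn adj ?D" by (rule conn_set_vpath)
  have "xs ! 3 \<in> ?D" "xs ! j \<in> ?D"
    using xs(3) \<open>j = ?n - 1\<close> by (auto simp: in_set_conv_nth intro: exI[of _ 0] exI[of _ "?n - 4"])
  moreover have "adj (xs ! 2) (xs ! 3)" "adj (xs ! 0) (xs ! 1)" "adj (xs ! 2) (xs ! 1)"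
    using suc[of 2] suc[of 0] adj_sym[OF suc[of 1]] xs(3) by (simp_all add: eval_nat_numeral)
  moreover have "touch adj {xs ! 0} ?D" "touch adj {xs ! 2} ?D"
    using calculation ij(3) \<open>i = 0\<close> by (auto simp: touch_def)
  moreover have "xs ! k \<notin> ?D" if "k < 3" for k
    using that xs(3) by (auto simp: in_set_conv_nth eq)
  moreover have "xs ! 0 \<noteq> xs ! 1" "xs ! 0 \<noteq> xs ! 2" "xs ! 1 \<noteq> xs ! 2"
    using xs by (auto simp: eq vpath_def)
  moreover have "xs ! 0 \<in> H" "xs ! 1 \<in> H" "xs ! 2 \<in> H" using mem[of 0] mem[of 1] mem[of 2] xs by (auto simp: vpath_def)
  moreover have "z \<notin> ?D" using xs(2) by (auto dest: in_set_dropD)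
  ultimately show False
    by (intro no_K23_minor[of "{xs ! 0}" "{xs ! 2}" "{xs ! 1}" "{z}" ?D])
      (use D ij \<open>i = 0\<close> universal adj_commute in \<open>auto simp: touch_def\<close>)
qed

text \<open>The path is induced and spans a component, so an edge of G - z at one of its vertices
  changes the position by one; two edges cannot bridge a gap of three.\<close>

lemma path_far_apart:
  assumes xs: "vpath adj xs" "length xs \<ge> 4"
    and closed: "nbr_closed (set xs)"
    and ij: "i + 3 \<le> j" "j < length xs"
  shows "\<not> adj (xs ! i) (xs ! j)" "\<not> (\<exists>w. w \<noteq> z \<and> adj (xs ! i) w \<and> adj w (xs ! j))"
proof -
  have "set xs \<subseteq> H" using closed by (simp add: nbr_closed_def)
  note ind = path_induced[OF xs(1) this xs(2)]
  show "\<not> adj (xs ! i) (xs ! j)"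
    using ind[of i j] ij by auto
  have near: "k \<le> l + 1 \<and> l \<le> k + 1" if "adj (xs ! k) (xs ! l)" "k < length xs" "l < length xs" for k l
    using ind[of k l] ind[of l k] that adj_sym[OF that(1)] by (cases k l rule: linorder_cases) auto
  show "\<not> (\<exists>w. w \<noteq> z \<and> adj (xs ! i) w \<and> adj w (xs ! j))"
  proof
    assume "\<exists>w. w \<noteq> z \<and> adj (xs ! i) w \<and> adj w (xs ! j)"
    then obtain w where w: "w \<noteq> z" "adj (xs ! i) w" "adj w (xs ! j)" by blast
    have "w \<in> set xs"
      using nbr_closedD[OF closed, of "xs ! i" w] w adj_V2[OF w(2)] ij by auto
    then obtain l where l: "l < length xs" "w = xs ! l" by (auto simp: in_set_conv_nth)
    then show False
      using near[of i l] near[of l j] w ij by simp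
  qed
qed

text \<open>The lengths (1,1), (2,1), (2,2), (3,1), (3,2), (3,3) give the graphs (c), (e), (g), (h),
  (j), (k).\<close>

lemma spans_two_paths:
  assumes xs: "vpath adj xs" "length xs \<le> 3" and ys: "vpath adj ys" "length ys \<le> length xs"
    and V: "V = insert z (set xs \<union> set ys)" "set xs \<inter> set ys = {}" "z \<notin> set xs" "z \<notin> set ys"
  shows "spans 3 {(0, 1), (1, 2)} \<or> spans 4 {(0, 1), (1, 2), (0, 2), (2, 3)} \<or>
    spans 5 {(0, 1), (0, 2), (0, 3), (0, 4), (1, 2), (3, 4)} \<or>
    spans 5 {(0, 1), (0, 2), (0, 3), (0, 4), (2, 3), (3, 4)} \<or>
    spans 6 {(0, 1), (0, 2), (0, 3), (0, 4), (0, 5), (1, 2), (3, 4), (4, 5)} \<or>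
    spans 7 {(0, 1), (0, 2), (0, 3), (0, 4), (0, 5), (0, 6), (1, 2), (2, 3), (4, 5), (5, 6)}"
    (is "?c \<or> ?e \<or> ?g \<or> ?h \<or> ?j \<or> ?k")
proof -
  have zx: "\<forall>x \<in> set xs \<union> set ys. adj z x \<and> adj x z"
  proof
    fix x assume "x \<in> set xs \<union> set ys"
    then have "adj z x" using V by (intro universal) auto
    then show "adj z x \<and> adj x z" using adj_sym by blast
  qed
  have "length xs \<noteq> 0" "length ys \<noteq> 0" using xs ys by (auto simp: vpath_def)
  then consider "length xs = 1" "length ys = 1" | "length xs = 2" "length ys = 1" |
    "length xs = 2" "length ys = 2" | "length xs = 3" "length ys = 1" |
    "length xs = 3" "length ys = 2" | "length xs = 3" "length ys = 3"
    using xs(2) ys(2) by linarith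
  then show ?thesis
  proof cases
    case 1
    then obtain x y where "xs = [x]" "ys = [y]" by (auto simp: length_Suc_conv)
    then have ?c using V xs ys zx by (intro spansI[of "[x, z, y]"]) (auto simp: vpath_def)
    then show ?thesis by blast
  next
    case 2
    then obtain x x' y where "xs = [x, x']" "ys = [y]" by (auto simp: length_Suc_conv numeral_eq_Suc)
    then have ?e using V xs ys zx by (intro spansI[of "[x, x', z, y]"]) (auto simp: vpath_def)
    then show ?thesis by blast
  next
    case 3
    then obtain x x' y y' where "xs = [x, x']" "ys = [y, y']" by (auto simp: length_Suc_conv numeral_eq_Suc)
    then have ?g using V xs ys zx by (intro spansI[of "[z, x, x', y, y']"]) (auto simp: vpath_def)
    then show ?thesis by blast
  next
    case 4
    then obtain x x' x'' y where "xs = [x, x', x'']" "ys = [y]"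
      by (auto simp: length_Suc_conv numeral_eq_Suc)
    then have ?h using V xs ys zx by (intro spansI[of "[z, y, x, x', x'']"]) (auto simp: vpath_def)
    then show ?thesis by blast
  next
    case 5
    then obtain x x' x'' y y' where "xs = [x, x', x'']" "ys = [y, y']"
      by (auto simp: length_Suc_conv numeral_eq_Suc)
    then have ?j using V xs ys zx by (intro spansI[of "[z, y, y', x, x', x'']"]) (auto simp: vpath_def)
    then show ?thesis by blast
  next
    case 6
    then obtain x x' x'' y y' y'' where "xs = [x, x', x'']" "ys = [y, y', y'']"
      by (auto simp: length_Suc_conv numeral_eq_Suc)
    then have ?k using V xs ys zx by (intro spansI[of "[z, y, y', y'', x, x', x'']"]) (auto simp: vpath_def)
    then show ?thesis by blast
  qed
qed

text \<open>Up to four vertices, \<open>z\<close> extends the path to (b) or (c) or closes it to (d)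
  or (f). With five or six vertices one edge of the path is dropped, leaving pieces of 2 and 3 or of
  3 and 3 vertices, as in (j) and (k).\<close>

lemma spans_one_path:
  assumes xs: "vpath adj xs" "length xs \<le> 6" and V: "V = insert z (set xs)" "z \<notin> set xs"
  shows "spans 2 {(0, 1)} \<or> spans 3 {(0, 1), (1, 2)} \<or> spans 4 {(0, 1), (1, 2), (2, 3), (3, 0)} \<or>
    spans 5 {(0, 1), (1, 2), (2, 3), (3, 4), (4, 0)} \<or>
    spans 6 {(0, 1), (0, 2), (0, 3), (0, 4), (0, 5), (1, 2), (3, 4), (4, 5)} \<or>
    spans 7 {(0, 1), (0, 2), (0, 3), (0, 4), (0, 5), (0, 6), (1, 2), (2, 3), (4, 5), (5, 6)}"
    (is "?b \<or> ?c \<or> ?d \<or> ?f \<or> ?j \<or> ?k")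
proof -
  have zx: "\<forall>x \<in> set xs. adj z x \<and> adj x z"
  proof
    fix x assume "x \<in> set xs"
    then have "adj z x" using V by (intro universal) auto
    then show "adj z x \<and> adj x z" using adj_sym by blast
  qed
  have "length xs \<noteq> 0" using xs by (auto simp: vpath_def)
  then consider "length xs = 1" | "length xs = 2" | "length xs = 3" | "length xs = 4" |
    "length xs = 5" | "length xs = 6"
    using xs(2) by linarith
  then show ?thesis
  proof cases
    case 1
    then have ?b using V xs zx by (intro spansI[of "z # xs"]) (auto simp: vpath_def length_Suc_conv)
    then show ?thesis by blast
  next
    case 2
    then have ?c using V xs zx
      by (intro spansI[of "z # xs"]) (auto simp: vpath_def length_Suc_conv numeral_eq_Suc)
    then show ?thesis by blast
  next
    case 3
    then have ?d using V xs zx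
      by (intro spansI[of "z # xs"]) (auto simp: vpath_def length_Suc_conv numeral_eq_Suc)
    then show ?thesis by blast
  next
    case 4
    then have ?f using V xs zx
      by (intro spansI[of "z # xs"]) (auto simp: vpath_def length_Suc_conv numeral_eq_Suc)
    then show ?thesis by blast
  next
    case 5
    then have ?j using V xs zx
      by (intro spansI[of "z # xs"]) (auto simp: vpath_def length_Suc_conv numeral_eq_Suc)
    then show ?thesis by blast
  next
    case 6
    then have ?k using V xs zx
      by (intro spansI[of "z # xs"]) (auto simp: vpath_def length_Suc_conv numeral_eq_Suc)
    then show ?thesis by blast
  qed
qed

text \<open>\<open>cls\<close> stands for the direction of the arc at \<open>z\<close>. All that
  matters is that it takes two values.\<close>

lemma spans_universal:
  fixes cls :: "'a \<Rightarrow> bool"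
  assumes cls: "\<And>x y. \<lbrakk>x \<in> H; y \<in> H; x \<noteq> y; cls x = cls y\<rbrakk> \<Longrightarrow>
    adj x y \<or> (\<exists>w. w \<noteq> z \<and> adj x w \<and> adj w y)"
  shows "spans 1 {} \<or> spans 2 {(0, 1)} \<or> spans 3 {(0, 1), (1, 2)} \<or>
    spans 4 {(0, 1), (1, 2), (2, 3), (3, 0)} \<or> spans 4 {(0, 1), (1, 2), (0, 2), (2, 3)} \<or>
    spans 5 {(0, 1), (1, 2), (2, 3), (3, 4), (4, 0)} \<or>
    spans 5 {(0, 1), (0, 2), (0, 3), (0, 4), (1, 2), (3, 4)} \<or>
    spans 5 {(0, 1), (0, 2), (0, 3), (0, 4), (2, 3), (3, 4)} \<or>
    spans 6 {(0, 1), (0, 2), (0, 3), (0, 4), (0, 5), (1, 2), (3, 4), (4, 5)} \<or>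
    spans 7 {(0, 1), (0, 2), (0, 3), (0, 4), (0, 5), (0, 6), (1, 2), (2, 3), (4, 5), (5, 6)}"
proof (cases "H = {}")
  case True
  then have "spans 1 {}" using z_V by (intro spansI[of "[z]"]) auto
  then show ?thesis by blast
next
  case False
  obtain xs where xs: "vpath adj xs" "set xs \<subseteq> H"
    "\<And>y. y \<in> H \<Longrightarrow> y \<notin> set xs \<Longrightarrow> \<not> adj (hd xs) y \<and> \<not> adj (last xs) y"
    using maximal_path[of H] False by blast
  have cx: "nbr_closed (set xs)"
    using xs by (intro maximal_path_closed[of H xs]) (auto simp: nbr_closed_def)
  have far: "cls (us ! i) \<noteq> cls (us ! j)"
    if us: "vpath adj us" "length us \<ge> 4" "nbr_closed (set us)" "i + 3 \<le> j" "j < length us" for us i j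
  proof -
    have "us ! i \<noteq> us ! j" using us(1,4,5) by (simp add: vpath_def nth_eq_iff_index_eq)
    moreover have "i < length us" using us(4,5) by simp
    then have "us ! i \<in> H" "us ! j \<in> H"
      using us(3,5) nth_mem unfolding nbr_closed_def by blast+
    ultimately show ?thesis
      using cls[of "us ! i" "us ! j"] path_far_apart[OF us] by blast
  qed
  \<comment> \<open>No path with at most two edges that avoids \<open>z\<close> leaves a union of
    components.\<close>
  have sep: "cls x \<noteq> cls y" if U: "nbr_closed U" "x \<in> U" "y \<in> H" "y \<notin> U" for U x y
  proof
    assume "cls x = cls y"
    then consider "adj x y" | w where "w \<noteq> z" "adj x w" "adj w y"
      using cls[of x y] U unfolding nbr_closed_def by blast
    then show False
    proof cases
      case 1
      then show False using nbr_closedD[OF U(1-3)] U(4) by blast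
    next
      case 2
      then have "w \<in> U" using nbr_closedD[OF U(1,2), of w] adj_V2[OF 2(2)] by blast
      then show False using nbr_closedD[OF U(1) _ U(3) 2(3)] U(4) by blast
    qed
  qed
  show ?thesis
  proof (cases "H = set xs")
    case True
    \<comment> \<open>Positions 0, 3 and 6 would have pairwise different truth values.\<close>
    have "length xs \<le> 6"
    proof (rule ccontr)
      assume l: "\<not> length xs \<le> 6"
      then show False
        using far[OF xs(1) _ cx, of 0 3] far[OF xs(1) _ cx, of 3 6] far[OF xs(1) _ cx, of 0 6]
        by auto
    qed
    moreover have "V = insert z (set xs)" "z \<notin> set xs" using True z_V by auto
    ultimately show ?thesis
      using spans_one_path[OF xs(1)] by blast
  next
    case False
    define S where "S = H - set xs"
    have S: "S \<subseteq> H" "S \<noteq> {}" using False xs(2) by (auto simp: S_def)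
    have cS: "nbr_closed S"
      unfolding nbr_closed_def
    proof (intro conjI ballI impI)
      fix x y assume "x \<in> S" "y \<in> H" "adj x y"
      then show "y \<in> S"
        using nbr_closedD[OF cx, of y x] adj_sym[of x y] unfolding S_def by blast
    qed (rule S(1))
    obtain ys where ys: "vpath adj ys" "set ys \<subseteq> S"
      "\<And>y. y \<in> S \<Longrightarrow> y \<notin> set ys \<Longrightarrow> \<not> adj (hd ys) y \<and> \<not> adj (last ys) y"
      using maximal_path[OF S] by blast
    have cy: "nbr_closed (set ys)"
      using maximal_path_closed[OF cS ys] by blast
    obtain x0 y0 where x0: "x0 \<in> set xs" and y0: "y0 \<in> set ys"
      using xs(1) ys(1) by (metis hd_in_set vpath_def)
    \<comment> \<open>With two truth values only, this makes \<open>cls\<close> constant on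
      \<open>set xs\<close> and constant on \<open>S\<close>.\<close>
    have xS: "cls x \<noteq> cls y" if "x \<in> set xs" "y \<in> S" for x y
      using sep[OF cx that(1), of y] that(2) by (auto simp: S_def)
    have short: "length us \<le> 3" if us: "vpath adj us" "nbr_closed (set us)"
      "\<And>x y. x \<in> set us \<Longrightarrow> y \<in> set us \<Longrightarrow> cls x = cls y" for us
    proof (rule ccontr)
      assume "\<not> length us \<le> 3"
      then show False
        using far[OF us(1) _ us(2), of 0 3] us(3)[of "us ! 0" "us ! 3"] us(1)
        by (simp add: vpath_def)
    qed
    have "cls x = cls x'" if "x \<in> set xs" "x' \<in> set xs" for x x'
      using xS[of x y0] xS[of x' y0] that y0 ys(2) by auto
    then have lx: "length xs \<le> 3" using short[OF xs(1) cx] by blast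
    have clsS: "cls y = cls y'" if "y \<in> S" "y' \<in> S" for y y'
      using xS[OF x0, of y] xS[OF x0, of y'] that by auto
    then have ly: "length ys \<le> 3" using short[OF ys(1) cy] ys(2) by blast
    \<comment> \<open>A vertex of \<open>S\<close> off \<open>ys\<close> would lie in another
      component and need a class of its own, but \<open>cls\<close> is constant on
      \<open>S\<close>.\<close>
    have "S = set ys"
    proof (rule ccontr)
      assume "S \<noteq> set ys"
      then obtain u where u: "u \<in> S" "u \<notin> set ys" using ys(2) by blast
      then show False
        using sep[OF cy y0, of u] clsS[of y0 u] S(1) ys(2) y0 by blast
    qed
    then have V: "V = insert z (set xs \<union> set ys)" "set xs \<inter> set ys = {}" "z \<notin> set xs" "z \<notin> set ys"
      using xs(2) z_V unfolding S_def by auto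
    have V': "V = insert z (set ys \<union> set xs)" "set ys \<inter> set xs = {}"
      using V by auto
    show ?thesis
    proof (cases "length ys \<le> length xs")
      case True
      then show ?thesis using spans_two_paths[OF xs(1) lx ys(1) _ V] by blast
    next
      case False
      then show ?thesis using spans_two_paths[OF ys(1) ly xs(1) _ V' V(4,3)] by linarith
    qed
  qed
qed

end

section \<open>The eleven graphs\<close>

lemma contains_spanning_copy_graph_on:
  assumes G: "pair_graph G" and sp: "spanned_by (pverts G) (\<lambda>u v. (u, v) \<in> parcs G) n F"
    and F: "\<forall>(i, j) \<in> F. i < n \<and> j < n \<and> i \<noteq> j"
  shows "contains_spanning_copy G (graph_on {..<n} F)"
proof -
  obtain xs where xs: "length xs = n" "distinct xs" "set xs = pverts G"
    "\<forall>(i, j) \<in> F. (xs ! i, xs ! j) \<in> parcs G"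
    using sp unfolding spanned_by_def by blast
  have "sym (parcs G)" using G by (simp add: pair_graph_iff)
  show ?thesis
  proof (rule contains_spanning_copyI[OF G, of _ "(!) xs"])
    show "pair_graph (graph_on {..<n} F)"
      using F by (auto simp: pair_graph_iff pair_digraph_iff graph_on_def intro: sym_Un_converse)
    show "bij_betw ((!) xs) (pverts (graph_on {..<n} F)) (pverts G)"
      using xs by (intro bij_betw_nth) (auto simp: graph_on_def)
    show "(xs ! u, xs ! v) \<in> parcs G" if "(u, v) \<in> parcs (graph_on {..<n} F)" for u v
      using that xs(4) symD[OF \<open>sym (parcs G)\<close>] by (auto simp: graph_on_def)
  qed
qed

lemma lessThan_le_7:
  "{..<1::nat} = {0}" "{..<2::nat} = {0, 1}" "{..<3::nat} = {0, 1, 2}" "{..<4::nat} = {0, 1, 2, 3}"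
  "{..<5::nat} = {0, 1, 2, 3, 4}" "{..<6::nat} = {0, 1, 2, 3, 4, 5}" "{..<7::nat} = {0, 1, 2, 3, 4, 5, 6}"
  by auto

lemma graph_on_lessThan:
  "graph_a = graph_on {..<1} {}"
  "graph_b = graph_on {..<2} {(0, 1)}"
  "graph_c = graph_on {..<3} {(0, 1), (1, 2)}"
  "graph_d = graph_on {..<4} {(0, 1), (1, 2), (2, 3), (3, 0)}"
  "graph_e = graph_on {..<4} {(0, 1), (1, 2), (0, 2), (2, 3)}"
  "graph_f = graph_on {..<5} {(0, 1), (1, 2), (2, 3), (3, 4), (4, 0)}"
  "graph_g = graph_on {..<5} {(0, 1), (0, 2), (0, 3), (0, 4), (1, 2), (3, 4)}"
  "graph_h = graph_on {..<5} {(0, 1), (0, 2), (0, 3), (0, 4), (2, 3), (3, 4)}"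
  "graph_i = graph_on {..<6} {(0, 1), (1, 3), (3, 2), (2, 0), (1, 4), (4, 3), (3, 5), (5, 2)}"
  "graph_j = graph_on {..<6} {(0, 1), (0, 2), (0, 3), (0, 4), (0, 5), (1, 2), (3, 4), (4, 5)}"
  "graph_k = graph_on {..<7}
     {(0, 1), (0, 2), (0, 3), (0, 4), (0, 5), (0, 6), (1, 2), (2, 3), (4, 5), (5, 6)}"
  by (simp_all only: lessThan_le_7 graph_a_def graph_b_def graph_c_def graph_d_def graph_e_def
      graph_f_def graph_g_def graph_h_def graph_i_def graph_j_def graph_k_def)

text \<open>
  In the graphs with a vertex \<open>z\<close> joined to all others, one side of \<open>z\<close> is directed into \<open>z\<close>, the other
  side out of \<open>z\<close>, and the remaining paths are directed from end to end; the other graphs are directed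
  as listed.
\<close>

lemma orientable_graphs:
  assumes "T \<in> {graph_a, graph_b, graph_c, graph_d, graph_e, graph_f,
    graph_g, graph_h, graph_i, graph_j, graph_k}"
  shows "\<exists>A \<subseteq> parcs T. asym A \<and> dipath_complete (pverts T) A"
proof -
  have a: "\<exists>A \<subseteq> parcs graph_a. asym A \<and> dipath_complete (pverts graph_a) A"
    by (intro exI[of _ "{}"])
      (simp add: graph_a_def graph_on_def asym_iff dipath_complete_def)
  have b: "\<exists>A \<subseteq> parcs graph_b. asym A \<and> dipath_complete (pverts graph_b) A"
    by (intro exI[of _ "{(0, 1)}"])
      (simp add: graph_b_def graph_on_def asym_iff dipath_complete_def)
  have c: "\<exists>A \<subseteq> parcs graph_c. asym A \<and> dipath_complete (pverts graph_c) A"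
    by (intro exI[of _ "{(0, 1), (1, 2)}"])
      (simp add: graph_c_def graph_on_def asym_iff dipath_complete_def)
  have d: "\<exists>A \<subseteq> parcs graph_d. asym A \<and> dipath_complete (pverts graph_d) A"
    by (intro exI[of _ "{(0, 1), (1, 2), (2, 3), (3, 0)}"])
      (auto simp: graph_d_def graph_on_def asym_iff dipath_complete_def)
  have e: "\<exists>A \<subseteq> parcs graph_e. asym A \<and> dipath_complete (pverts graph_e) A"
    by (intro exI[of _ "{(0, 1), (1, 2), (0, 2), (2, 3)}"])
      (auto simp: graph_e_def graph_on_def asym_iff dipath_complete_def)
  have f: "\<exists>A \<subseteq> parcs graph_f. asym A \<and> dipath_complete (pverts graph_f) A"
    by (intro exI[of _ "{(0, 1), (1, 2), (2, 3), (3, 4), (4, 0)}"])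
      (auto simp: graph_f_def graph_on_def asym_iff dipath_complete_def)
  have g: "\<exists>A \<subseteq> parcs graph_g. asym A \<and> dipath_complete (pverts graph_g) A"
    by (intro exI[of _ "{(1, 0), (2, 0), (0, 3), (0, 4), (1, 2), (3, 4)}"])
      (auto simp: graph_g_def graph_on_def asym_iff dipath_complete_def)
  have h: "\<exists>A \<subseteq> parcs graph_h. asym A \<and> dipath_complete (pverts graph_h) A"
    by (intro exI[of _ "{(1, 0), (0, 2), (0, 3), (0, 4), (2, 3), (3, 4)}"])
      (auto simp: graph_h_def graph_on_def asym_iff dipath_complete_def)
  have i: "\<exists>A \<subseteq> parcs graph_i. asym A \<and> dipath_complete (pverts graph_i) A"
    by (intro exI[of _ "{(0, 1), (1, 3), (3, 2), (2, 0), (1, 4), (4, 3), (3, 5), (5, 2)}"])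
      (auto simp: graph_i_def graph_on_def asym_iff dipath_complete_def)
  have j: "\<exists>A \<subseteq> parcs graph_j. asym A \<and> dipath_complete (pverts graph_j) A"
    by (intro exI[of _ "{(1, 0), (2, 0), (0, 3), (0, 4), (0, 5), (1, 2), (3, 4), (4, 5)}"])
      (auto simp: graph_j_def graph_on_def asym_iff dipath_complete_def)
  have k: "\<exists>A \<subseteq> parcs graph_k. asym A \<and> dipath_complete (pverts graph_k) A"
    by (intro exI[of _ "{(1, 0), (2, 0), (3, 0), (0, 4), (0, 5), (0, 6), (1, 2), (2, 3), (4, 5), (5, 6)}"])
      (auto simp: graph_k_def graph_on_def asym_iff dipath_complete_def)
  show ?thesis
    using assms a b c d e f g h i j k by (elim insertE) simp_all
qed

section \<open>From graphs to the abstract setting, and the equivalence\<close>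

lemma spanning_copy_if_oclique:
  fixes G :: "'a pair_pre_digraph"
  assumes G: "pair_graph G" "pverts G \<noteq> {}" "outerplanar G"
    and A: "A \<subseteq> parcs G" "asym A" "dipath_complete (pverts G) A"
  shows "\<exists>T \<in> {graph_a, graph_b, graph_c, graph_d, graph_e, graph_f,
    graph_g, graph_h, graph_i, graph_j, graph_k}. contains_spanning_copy G T"
proof -
  let ?adj = "\<lambda>u v. (u, v) \<in> parcs G"
  let ?sp = "spanned_by (pverts G) ?adj"
  have G': "finite (pverts G)" "parcs G \<subseteq> pverts G \<times> pverts G" "\<And>x. (x, x) \<notin> parcs G" "sym (parcs G)"
    using G(1) by (auto simp: pair_graph_iff pair_digraph_iff)
  interpret theta_free "pverts G" ?adj
  proof
    show "x \<in> pverts G" if "(x, y) \<in> parcs G" for x y using that G'(2) by blast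
    show "(y, x) \<in> parcs G" if "(x, y) \<in> parcs G" for x y using that G'(4) by (auto dest: symD)
  qed (use G' outerplanar_no_theta[OF G(1,3)] in blast)+
  interpret diam2_theta_free "pverts G" ?adj
  proof
    fix x y assume "x \<in> pverts G" "y \<in> pverts G" "x \<noteq> y"
    then show "(x, y) \<in> parcs G \<or> (\<exists>w. (x, w) \<in> parcs G \<and> (w, y) \<in> parcs G)"
      using A(1,3) adj_sym unfolding dipath_complete_def by blast
  qed
  have "?sp 1 {} \<or> ?sp 2 {(0, 1)} \<or> ?sp 3 {(0, 1), (1, 2)} \<or>
    ?sp 4 {(0, 1), (1, 2), (2, 3), (3, 0)} \<or> ?sp 4 {(0, 1), (1, 2), (0, 2), (2, 3)} \<or>
    ?sp 5 {(0, 1), (1, 2), (2, 3), (3, 4), (4, 0)} \<or>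
    ?sp 5 {(0, 1), (0, 2), (0, 3), (0, 4), (1, 2), (3, 4)} \<or>
    ?sp 5 {(0, 1), (0, 2), (0, 3), (0, 4), (2, 3), (3, 4)} \<or>
    ?sp 6 {(0, 1), (1, 3), (3, 2), (2, 0), (1, 4), (4, 3), (3, 5), (5, 2)} \<or>
    ?sp 6 {(0, 1), (0, 2), (0, 3), (0, 4), (0, 5), (1, 2), (3, 4), (4, 5)} \<or>
    ?sp 7 {(0, 1), (0, 2), (0, 3), (0, 4), (0, 5), (0, 6), (1, 2), (2, 3), (4, 5), (5, 6)}"
  proof (cases "\<exists>z \<in> pverts G. \<forall>y \<in> pverts G. y \<noteq> z \<longrightarrow> (z, y) \<in> parcs G")
    case True
    then obtain z where z: "z \<in> pverts G" "\<And>y. y \<in> pverts G \<Longrightarrow> y \<noteq> z \<Longrightarrow> (z, y) \<in> parcs G" by blast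
    interpret universal_theta_free "pverts G" ?adj z
      by unfold_locales (use z in auto)
    \<comment> \<open>If \<open>z\<close> were the middle of the directed path, one of
      \<open>x\<close>, \<open>y\<close> would have its arc into \<open>z\<close> and the other its
      arc out of \<open>z\<close>, against the equality of the classes.\<close>
    have "(x, y) \<in> parcs G \<or> (\<exists>w. w \<noteq> z \<and> (x, w) \<in> parcs G \<and> (w, y) \<in> parcs G)"
      if xy: "x \<in> pverts G - {z}" "y \<in> pverts G - {z}" "x \<noteq> y" "((z, x) \<in> A) = ((z, y) \<in> A)" for x y
    proof -
      consider "(x, y) \<in> A" | "(y, x) \<in> A" | w where "(x, w) \<in> A" "(w, y) \<in> A" | w where "(y, w) \<in> A" "(w, x) \<in> A"
        using A(3) xy(1-3) unfolding dipath_complete_def by blast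
      then show ?thesis
      proof cases
        case 3
        then have "w \<noteq> z" using xy(4) asymD[OF A(2)] by blast
        then show ?thesis using 3 A(1) by blast
      next
        case 4
        then have "w \<noteq> z" using xy(4) asymD[OF A(2)] by blast
        moreover have "(x, w) \<in> parcs G" "(w, y) \<in> parcs G" using 4 A(1) adj_sym by blast+
        ultimately show ?thesis by blast
      qed (use A(1) adj_sym in blast)+
    qed
    then show ?thesis
      using spans_universal[of "\<lambda>x. (z, x) \<in> A"] by argo
  next
    case False
    then show ?thesis
      using spans_no_universal[OF G(2)] by blast
  qed
  then show ?thesis
    unfolding graph_on_lessThan
    by (elim disjE) (drule contains_spanning_copy_graph_on[OF G(1)], simp, simp)+
qed

theorem theorem1p6:
  fixes G :: "'a pair_pre_digraph"
  assumes "pair_graph G" and "pverts G \<noteq> {}" and "outerplanar G"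
  shows "orientable_as_oclique G \<longleftrightarrow>
    (\<exists>T \<in> {graph_a, graph_b, graph_c, graph_d, graph_e, graph_f,
            graph_g, graph_h, graph_i, graph_j, graph_k}. contains_spanning_copy G T)"
proof
  assume "orientable_as_oclique G"
  then show "\<exists>T \<in> {graph_a, graph_b, graph_c, graph_d, graph_e, graph_f,
      graph_g, graph_h, graph_i, graph_j, graph_k}. contains_spanning_copy G T"
    using spanning_copy_if_oclique[OF assms] unfolding orientable_as_oclique_iff[OF assms(1)] by blast
next
  assume "\<exists>T \<in> {graph_a, graph_b, graph_c, graph_d, graph_e, graph_f,
      graph_g, graph_h, graph_i, graph_j, graph_k}. contains_spanning_copy G T"
  then obtain T where T: "T \<in> {graph_a, graph_b, graph_c, graph_d, graph_e, graph_f,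
      graph_g, graph_h, graph_i, graph_j, graph_k}" "contains_spanning_copy G T" by blast
  obtain A where "A \<subseteq> parcs T" "asym A" "dipath_complete (pverts T) A"
    using orientable_graphs[OF T(1)] by blast
  moreover have "parcs T \<subseteq> pverts T \<times> pverts T"
    using T(1) by (elim insertE) (auto simp: graph_on_lessThan graph_on_def)
  ultimately show "orientable_as_oclique G"
    using orientable_if_contains_spanning_copy[OF assms(1) T(2)] by blast
qed

end
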